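(* Let $N, M, K$ be positive integers with $N<K$ and $M<K$, let $\mathbf{H}_{\mathrm F}\in\mathbb{C}^{K\times N}$ and $\mathbf{H}_{\mathrm B}\in\mathbb{C}^{M\times K}$, and let $P>0$ (total transmit power) and $\sigma_n^2>0$ (noise power) be real numbers. Let $$\mathbf{H}_{\mathrm F}=\mathbf{U}_{\mathrm F}\mathbf{\Sigma}_{\mathrm F}\mathbf{V}_{\mathrm F}^{\dag},\qquad \mathbf{H}_{\mathrm B}=\mathbf{U}_{\mathrm B}\mathbf{\Sigma}_{\mathrm B}\mathbf{V}_{\mathrm B}^{\dag}$$ be singular value decompositions, where $\mathbf{U}_{\mathrm F}\in\mathbb{C}^{K\times K}$, $\mathbf{V}_{\mathrm F}\in\mathbb{C}^{N\times N}$, $\mathbf{U}_{\mathrm B}\in\mathbb{C}^{M\times M}$, $\mathbf{V}_{\mathrm B}\in\mathbb{C}^{K\times K}$ are unitary, $\mathbf{\Sigma}_{\mathrm F}\in\mathbb{C}^{K\times N}$ is the rectangular diagonal matrix whose main diagonal consists of the ordered (non-zero and zero) singular values $\sigma_{\mathrm F1},\ldots,\sigma_{\mathrm FN}$ of $\mathbf{H}_{\mathrm F}$, and $\mathbf{\Sigma}_{\mathrm B}\in\mathbb{C}^{M\times K}$ is the rectangular diagonal matrix whose main diagonal consists of the ordered (non-zero and zero) singular values $\sigma_{\mathrm B1},\ldots,\sigma_{\mathrm BM}$ of $\mathbf{H}_{\mathrm B}$. Define the end-to-end channel capacity $$C=\max\ \log\det\left(\mathbf{I}_M+\frac{1}{\sigma_n^2}\,\mathbf{H}\mathbf{Q}\mathbf{H}^{\dag}\right),\qquad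 \mathbf{H}=\mathbf{H}_{\mathrm B}\mathbf{\Phi}\mathbf{H}_{\mathrm F},$$ where the maximum is over all positive semi-definite $\mathbf{Q}\in\mathbb{C}^{N\times N}$ with $\operatorname{tr}(\mathbf{Q})\le P$ and all $\mathbf{\Phi}\in\mathbb{C}^{K\times K}$ with $\mathbf{\Phi}\mathbf{\Phi}^{\dag}=\mathbf{I}_K$. Then $$C=\sum_{i=1}^{\min\{N,M\}}\log\left(1+\sigma_{\mathrm Fi}^2\sigma_{\mathrm Bi}^2\frac{P_i}{\sigma_n^2}\right),$$ where $$P_i=\left(\mu-\frac{\sigma_n^2}{\sigma_{\mathrm Fi}^2\sigma_{\mathrm Bi}^2}\right)^{+}=\max\left(0,\ \mu-\frac{\sigma_n^2}{\sigma_{\mathrm Fi}^2\sigma_{\mathrm Bi}^2}\right)$$ and $\mu$ is obtained by fulfilling the identity $\sum_{i=1}^{\min\{N,M\}}P_i=P$. In addition, $C$ is attained by setting $$\mathbf{Q}=\mathrm{diag}\{P_1,P_2,\ldots\},\qquad \mathbf{\Phi}=\mathbf{V}_{\mathrm B}\mathbf{U}_{\mathrm F}^{\dag}.$$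
   Context: Setting: a MIMO transmitter with $N$ antennas communicates with a MIMO receiver with $M$ antennas through a reconfigurable intelligent surface (RIS) with $K$ elements. $\mathbf{H}_{\mathrm F}$ is the transmitter-RIS channel, $\mathbf{H}_{\mathrm B}$ is the RIS-receiver channel, $\mathbf{\Phi}$ is the (unitary, not necessarily diagonal) matrix of RIS reflection coefficients, and the received signal is $\mathbf{y}=\mathbf{H}\mathbf{x}+\mathbf{n}$ with $\mathbf{H}=\mathbf{H}_{\mathrm B}\mathbf{\Phi}\mathbf{H}_{\mathrm F}$, Gaussian noise $\mathbf{n}\sim\mathcal{CN}(\mathbf{0},\sigma_n^2\mathbf{I}_M)$, and transmit covariance $\mathbf{Q}=\mathbb{E}[\mathbf{x}\mathbf{x}^{\dag}]$. The capacity $C$ is the maximum of the mutual information between $\mathbf{x}$ and $\mathbf{y}$ over $\mathbf{Q}$ and $\mathbf{\Phi}$. Notation: $(\cdot)^{\dag}$ is the conjugate transpose, $\mathbf{I}_m$ is the $m\times m$ identity matrix, $\operatorname{tr}$ is the trace, and $\mathrm{diag}\{v_1,v_2,\ldots\}$ is the matrix (here $N\times N$) whose main diagonal has elements $v_1,v_2,\ldots$ and whose other entries are zero.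
   Formalization: The optimal covariance is V_F diag{P_1,P_2,...} V_F^†, since diag{P_1,P_2,...} is not optimal for general V_F; if all products σ_Fi σ_Bi vanish, no μ fulfils the identity, and the claims are made with all P_i = 0. *)

theory Defs
  imports "Jordan_Normal_Form.Schur_Decomposition"
begin

text \<open>
  Matrices are those of \<^theory>\<open>Jordan_Normal_Form.Matrix\<close>, with dimensions as natural
  numbers and rows, columns and singular values indexed from 0. The conjugate transpose is
  \<^const>\<open>mat_adjoint\<close>.
\<close>

definition unitary_mat :: "nat \<Rightarrow> complex mat \<Rightarrow> bool" where
  "unitary_mat n U \<longleftrightarrow>
     U \<in> carrier_mat n n \<and> U * mat_adjoint U = 1\<^sub>m n \<and> mat_adjoint U * U = 1\<^sub>m n"

definition mat_trace :: "'a::comm_monoid_add mat \<Rightarrow> 'a" where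
  "mat_trace A = (\<Sum>i<dim_row A. A $$ (i, i))"

text \<open>
  The order on complex numbers is that of \<^theory>\<open>HOL-Library.Complex_Order\<close>:
  \<open>0 \<le> z\<close> means that \<open>z\<close> is real and nonnegative.
\<close>

definition psd_mat :: "nat \<Rightarrow> complex mat \<Rightarrow> bool" where
  "psd_mat n A \<longleftrightarrow>
     A \<in> carrier_mat n n \<and> mat_adjoint A = A \<and>
     (\<forall>v \<in> carrier_vec n. 0 \<le> (A *\<^sub>v v) \<bullet>c v)"

definition rect_diag :: "nat \<Rightarrow> nat \<Rightarrow> (nat \<Rightarrow> real) \<Rightarrow> complex mat" where
  "rect_diag r c s = Matrix.mat r c (\<lambda>(i, j). if i = j then complex_of_real (s i) else 0)"

definition is_svd ::
    "nat \<Rightarrow> nat \<Rightarrow> complex mat \<Rightarrow> complex mat \<Rightarrow> (nat \<Rightarrow> real) \<Rightarrow> complex mat \<Rightarrow> bool" where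
  "is_svd r c A U s V \<longleftrightarrow>
     unitary_mat r U \<and> unitary_mat c V \<and>
     (\<forall>i < min r c. 0 \<le> s i) \<and>
     (\<forall>i j. i \<le> j \<and> j < min r c \<longrightarrow> s j \<le> s i) \<and>
     A = U * rect_diag r c s * mat_adjoint V"

text \<open>
  Here \<open>noise\<close> is the noise power (the square of the standard deviation) and \<open>b\<close> the base of the
  logarithm. The determinant is real and positive for positive semidefinite \<open>Q\<close>; taking the real
  part only adjusts the type.
\<close>

definition rate :: "real \<Rightarrow> real \<Rightarrow> complex mat \<Rightarrow> complex mat \<Rightarrow> real" where
  "rate b noise H Q =
     log b (Re (Determinant.det
       (1\<^sub>m (dim_row H) + complex_of_real (1 / noise) \<cdot>\<^sub>m (H * Q * mat_adjoint H))))"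

definition feasible :: "nat \<Rightarrow> nat \<Rightarrow> real \<Rightarrow> complex mat \<Rightarrow> complex mat \<Rightarrow> bool" where
  "feasible N K P Q \<Phi> \<longleftrightarrow>
     psd_mat N Q \<and> Re (mat_trace Q) \<le> P \<and>
     \<Phi> \<in> carrier_mat K K \<and> \<Phi> * mat_adjoint \<Phi> = 1\<^sub>m K"

text \<open>
  \<^const>\<open>Greatest\<close> is a definite description, so the value below is meaningful only if the maximum
  exists; this has to be established separately.
\<close>

definition capacity ::
    "nat \<Rightarrow> nat \<Rightarrow> real \<Rightarrow> real \<Rightarrow> real \<Rightarrow> complex mat \<Rightarrow> complex mat \<Rightarrow> real" where
  "capacity N K b P noise HF HB =
     (GREATEST c. \<exists>Q \<Phi>. feasible N K P Q \<Phi> \<and> c = rate b noise (HB * \<Phi> * HF) Q)"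

text \<open>
  Power assigned to the \<open>i\<close>-th eigenchannel at water level \<open>\<mu>\<close>. A channel of gain 0 has inverse
  gain \<open>\<infinity>\<close> and hence gets no power; this case is separate because \<open>x / 0 = 0\<close> in HOL.
\<close>

definition wf_power ::
    "(nat \<Rightarrow> real) \<Rightarrow> (nat \<Rightarrow> real) \<Rightarrow> real \<Rightarrow> real \<Rightarrow> nat \<Rightarrow> real" where
  "wf_power sF sB noise \<mu> i =
     (if sF i * sB i = 0 then 0 else max 0 (\<mu> - noise / ((sF i)\<^sup>2 * (sB i)\<^sup>2)))"

text \<open>
  Only the first \<open>r\<close> powers are used; the remaining
  diagonal entries are 0.
\<close>

definition power_diag :: "nat \<Rightarrow> nat \<Rightarrow> (nat \<Rightarrow> real) \<Rightarrow> complex mat" where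
  "power_diag r N p = mat_diag N (\<lambda>i. if i < r then complex_of_real (p i) else 0)"

text \<open>
  The diagonal power allocation refers to the coordinates given by the right singular vectors of
  the transmitter-side channel, i.e. it is the covariance of \<open>V\<^sup>\<dagger> x\<close>; the covariance of the
  transmitted \<open>x\<close> itself is obtained by changing basis with \<open>V\<close>. Without the change of basis the
  allocation is not optimal in general: for the channel with a single nonzero entry 1, at position
  \<open>(0, 1)\<close>, all the power must go to antenna 1, although the strongest eigenchannel has index 0.
\<close>

definition wf_covariance :: "nat \<Rightarrow> nat \<Rightarrow> complex mat \<Rightarrow> (nat \<Rightarrow> real) \<Rightarrow> complex mat" where
  "wf_covariance r N V p = V * power_diag r N p * mat_adjoint V"

end

theory Submission
  imports Defs
begin

text \<open>
  Fix the surface and let \<open>g\<close> be the decreasing spectrum of \<open>A\<^sup>\<dagger> A / noise\<close>, where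
  \<open>A = HB \<Phi> HF\<close>. Concavity of the log-determinant, in the form \<open>det Z \<le> exp (tr Z - n)\<close>,
  bounds the rate for every water level \<open>\<mu> > 0\<close> by the Lagrangian dual value
  \<open>P / \<mu> + (\<Sum>i. h (\<mu> g i))\<close>, with \<open>h\<close> nondecreasing and convex in the logarithm of its argument.
  The leading minors of the diagonalised Gram matrix and the Cauchy--Binet formula show that each
  product \<open>g 0 \<cdots> g (k - 1)\<close> is at most the corresponding product of the numbers
  \<open>(sF i)\<^sup>2 (sB i)\<^sup>2 / noise\<close>, whatever \<open>\<Phi>\<close> is. Weak majorisation then replaces \<open>g\<close> by these
  numbers in the dual value, and at the water level the result equals the claimed capacity.
\<close>

section \<open>Unitary diagonalisation of Hermitian matrices\<close>

text \<open>The gains of the cascade are not bounded one by one: for 0 < e < 1, exchanging the two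
  coordinates between diag(1, e) and diag(1, e) turns the singular values 1, e^2 of the product into
  e, e, and the second one grows. Only the products of the first k gains are controlled, so the
  objective has to be brought into a form that respects such products; the dual value has this form,
  the rate at a fixed covariance does not. Duality also decouples \<Phi> from the covariance. The
  best covariance changes with \<Phi>, but the dual bound holds at every positive \<mu>, so one
  \<mu>, taken from the claimed optimum, serves all \<Phi> at once, and no covariance other than the
  claimed one is ever constructed. If all products \<open>sF i * sB i\<close> vanish, no water level
  exists; the dual bound is then P / \<mu> for every positive \<mu>, and large \<mu> show that the
  rate cannot be positive.\<close>

lemma mat_adjoint_dim [simp]:
  "dim_row (mat_adjoint A) = dim_col A" "dim_col (mat_adjoint A) = dim_row A"
  by (auto simp: mat_adjoint_def)

lemma mat_adjoint_index [simp]: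
  fixes A :: "complex mat"
  assumes "i < dim_col A" "j < dim_row A"
  shows "mat_adjoint A $$ (i, j) = cnj (A $$ (j, i))"
  using assms by (simp add: mat_adjoint_def mat_of_rows_index)

lemma mat_adjoint_carrier [simp, intro]:
  "A \<in> carrier_mat m n \<Longrightarrow> mat_adjoint A \<in> carrier_mat n m"
  by (auto simp: mat_adjoint_def)

lemma mat_adjoint_mult:
  fixes A B :: "complex mat"
  assumes "A \<in> carrier_mat m n" "B \<in> carrier_mat n k"
  shows "mat_adjoint (A * B) = mat_adjoint B * mat_adjoint A"
  using assms by (intro eq_matI) (auto simp: scalar_prod_def mult.commute)

lemma mat_adjoint_adjoint [simp]: "mat_adjoint (mat_adjoint A) = (A :: complex mat)"
  by (intro eq_matI) auto

lemma mat_adjoint_add: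
  fixes A B :: "complex mat"
  assumes "A \<in> carrier_mat m n" "B \<in> carrier_mat m n"
  shows "mat_adjoint (A + B) = mat_adjoint A + mat_adjoint B"
  using assms by (intro eq_matI) auto

lemma mat_adjoint_mat_diag: "mat_adjoint (mat_diag n f) = mat_diag n (\<lambda>i. cnj (f i))"
  by (intro eq_matI) (auto simp: mat_diag_def)

lemma mat_adjoint_inner:
  fixes A :: "complex mat"
  assumes "A \<in> carrier_mat m n" "v \<in> carrier_vec n" "w \<in> carrier_vec m"
  shows "(A *\<^sub>v v) \<bullet>c w = v \<bullet>c (mat_adjoint A *\<^sub>v w)"
proof -
  have "(A *\<^sub>v v) \<bullet>c w = (\<Sum>i<m. \<Sum>j<n. A $$ (i, j) * v $ j * cnj (w $ i))"
    using assms by (simp add: scalar_prod_def atLeast0LessThan sum_distrib_right)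
  also have "\<dots> = (\<Sum>j<n. \<Sum>i<m. A $$ (i, j) * v $ j * cnj (w $ i))"
    by (rule sum.swap)
  also have "\<dots> = v \<bullet>c (mat_adjoint A *\<^sub>v w)"
    using assms
    by (simp add: scalar_prod_def atLeast0LessThan sum_distrib_left mult_ac)
  finally show ?thesis .
qed

lemma unitary_mat_carrier: "unitary_mat n U \<Longrightarrow> U \<in> carrier_mat n n"
  by (simp add: unitary_mat_def)

lemma unitary_matI:
  assumes "U \<in> carrier_mat n n" "mat_adjoint U * U = 1\<^sub>m n"
  shows "unitary_mat n U"
  using assms mat_mult_left_right_inverse[of "mat_adjoint U" n U] by (simp add: unitary_mat_def)

lemma unitary_mat_adjoint: "unitary_mat n U \<Longrightarrow> unitary_mat n (mat_adjoint U)"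
  by (simp add: unitary_mat_def)

lemma unitary_mat_mult:
  assumes U: "unitary_mat n U" and V: "unitary_mat n V"
  shows "unitary_mat n (U * V)"
proof (rule unitary_matI)
  have c [simp]: "U \<in> carrier_mat n n" "V \<in> carrier_mat n n"
    using U V by (auto simp: unitary_mat_def)
  show "U * V \<in> carrier_mat n n" by (rule mult_carrier_mat[of _ n n]) auto
  have "mat_adjoint (U * V) * (U * V) = mat_adjoint V * (mat_adjoint U * U) * V"
    by (simp add: mat_adjoint_mult[of _ n n _ n] assoc_mult_mat[of _ n n _ n _ n] mult_carrier_mat[of _ n n _ n])
  also have "\<dots> = 1\<^sub>m n"
    using U V by (simp add: unitary_mat_def right_mult_one_mat[of _ n n])
  finally show "mat_adjoint (U * V) * (U * V) = 1\<^sub>m n" .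
qed

text \<open>Gram-Schmidt leaves the first vector of a list unchanged, so it is applied to a basis
  that begins with \<open>v\<close>. The result is orthogonal but not normalised; \<open>c\<close>
  is the reciprocal of the norm of \<open>v\<close>.\<close>

lemma unitary_mat_with_first_col:
  assumes v: "v \<in> carrier_vec n" and v0: "v \<noteq> 0\<^sub>v n"
  shows "\<exists>W c. unitary_mat n W \<and> col W 0 = c \<cdot>\<^sub>v v"
proof -
  interpret cof_vec_space n "TYPE(complex)" .
  define b where "b = basis_completion v"
  from basis_completion[OF v v0, folded b_def]
  have b: "distinct b" "\<not> lin_dep (set b)" "set b \<subseteq> carrier_vec n" "hd b = v" "length b = n"
    by auto
  have n: "n \<noteq> 0" using v v0 by auto
  with b obtain vs where bv: "b = v # vs" by (cases b) auto
  define ws where "ws = gram_schmidt n b"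
  from gram_schmidt_result[OF b(3,1,2) refl, folded ws_def]
  have ws: "set ws \<subseteq> carrier_vec n" "corthogonal ws" "length ws = n"
    using b by auto
  have hd: "hd ws = v" using gram_schmidt_hd[OF v, of vs] bv by (simp add: ws_def)
  have ws0: "ws ! 0 = v" using hd ws(3) n by (cases ws) auto
  have carr: "ws ! i \<in> carrier_vec n" if "i < n" for i
    using ws that by auto
  have orth: "(ws ! i \<bullet>c ws ! j = 0) = (i \<noteq> j)" if "i < n" "j < n" for i j
    using corthogonalD[OF ws(2)] ws(3) that by auto
  define s where "s j = sqrt (Re (ws ! j \<bullet>c ws ! j))" for j
  have pos: "ws ! j \<bullet>c ws ! j = complex_of_real (s j ^ 2)" "0 < s j" if "j < n" for j
  proof -
    have "0 < ws ! j \<bullet>c ws ! j"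
      using orth[OF that that] conjugate_square_greater_0_vec[OF carr[OF that]]
        carr[OF that] by auto
    then show "ws ! j \<bullet>c ws ! j = complex_of_real (s j ^ 2)" "0 < s j"
      by (auto simp: s_def less_complex_def complex_eq_iff)
  qed
  define W where "W = Matrix.mat n n (\<lambda>(i, j). (ws ! j) $ i / complex_of_real (s j))"
  have W: "W \<in> carrier_mat n n" by (simp add: W_def)
  have "mat_adjoint W * W = 1\<^sub>m n"
  proof (rule eq_matI)
    fix i j assume "i < dim_row (1\<^sub>m n)" "j < dim_col (1\<^sub>m n)"
    then have i: "i < n" and j: "j < n" by auto
    have "(mat_adjoint W * W) $$ (i, j) =
        (\<Sum>k<n. cnj ((ws ! i) $ k / complex_of_real (s i)) * ((ws ! j) $ k / complex_of_real (s j)))"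
      using i j W by (simp add: W_def scalar_prod_def atLeast0LessThan)
    also have "\<dots> = (ws ! j \<bullet>c ws ! i) / complex_of_real (s i * s j)"
      using i j carr[OF i, THEN carrier_vecD]
      by (simp add: scalar_prod_def atLeast0LessThan sum_divide_distrib mult_ac)
    also have "\<dots> = 1\<^sub>m n $$ (i, j)"
      using i j orth[OF j i] pos[OF i] by (auto simp: power2_eq_square)
    finally show "(mat_adjoint W * W) $$ (i, j) = 1\<^sub>m n $$ (i, j)" .
  qed (use W in auto)
  then have "unitary_mat n W" using W by (rule unitary_matI[rotated])
  moreover have "col W 0 = complex_of_real (1 / s 0) \<cdot>\<^sub>v v"
    using n ws0 v by (intro eq_vecI) (auto simp: W_def)
  ultimately show ?thesis by blast
qed

text \<open>Deflation: in a unitary basis that begins with an eigenvector, the first column is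
  \<open>e\<close> times a unit vector, and Hermitian symmetry clears the first row as well. The
  remaining block is Hermitian and its characteristic polynomial has lost the factor of
  \<open>e\<close>. Prescribing the list \<open>es\<close> fixes the order in which eigenvalues
  appear on the diagonal.\<close>

lemma hermitian_diagonalization_char_poly:
  fixes A :: "complex mat"
  assumes "A \<in> carrier_mat n n" "mat_adjoint A = A" "char_poly A = (\<Prod>e \<leftarrow> es. [:- e, 1:])"
  shows "\<exists>U. unitary_mat n U \<and> mat_adjoint U * A * U = mat_diag n (\<lambda>i. es ! i)"
  using assms
proof (induction es arbitrary: n A)
  case Nil
  with degree_monic_char_poly[of A n] have "n = 0" by auto
  with Nil show ?case
    by (intro exI[of _ "1\<^sub>m 0"]) (auto intro!: unitary_matI eq_matI simp: mat_diag_def)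
next
  case (Cons e es n A)
  note A [simp] = Cons.prems(1)
  have cp: "char_poly A = [:- e, 1:] * (\<Prod>e\<leftarrow>es. [:- e, 1:])"
    using Cons.prems by simp
  have e: "eigenvalue A e"
    unfolding eigenvalue_root_char_poly[OF A] cp by simp
  from find_eigenvector[OF A e] obtain v where v: "eigenvector A v e" by blast
  then have vc: "v \<in> carrier_vec n" and v0: "v \<noteq> 0\<^sub>v n" and ev: "A *\<^sub>v v = e \<cdot>\<^sub>v v"
    using A by (auto simp: eigenvector_def)
  obtain W c where W: "unitary_mat n W" and Wc: "col W 0 = c \<cdot>\<^sub>v v"
    using unitary_mat_with_first_col[OF vc v0] by blast
  have n: "n \<noteq> 0" using vc v0 by auto
  then obtain m where m: "n = Suc m" by (cases n) auto
  have W' [simp]: "W \<in> carrier_mat n n" using W by (rule unitary_mat_carrier)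
  define A' where "A' = mat_adjoint W * A * W"
  have A' [simp]: "A' \<in> carrier_mat n n"
    unfolding A'_def by (intro mult_carrier_mat[of _ n n]) auto
  have herm: "mat_adjoint A' = A'"
    by (simp add: A'_def mat_adjoint_mult[of _ n n _ n] Cons.prems(2)
        assoc_mult_mat[of _ n n _ n _ n] mult_carrier_mat[of _ n n _ n])
  have col0: "col A' 0 = e \<cdot>\<^sub>v unit_vec n 0"
  proof -
    have "col A' 0 = mat_adjoint W * A *\<^sub>v col W 0"
      using n by (simp add: A'_def col_mult2[of _ n n _ n] mult_carrier_mat[of _ n n _ n])
    also have "\<dots> = mat_adjoint W *\<^sub>v (A *\<^sub>v col W 0)"
      using n by (intro assoc_mult_mat_vec[of _ n n _ n]) (auto simp: mult_carrier_mat[of _ n n _ n])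
    also have "A *\<^sub>v col W 0 = e \<cdot>\<^sub>v col W 0"
      using vc by (simp add: Wc mult_mat_vec[of _ n n] ev smult_smult_assoc mult.commute)
    also have "mat_adjoint W *\<^sub>v (e \<cdot>\<^sub>v col W 0) = e \<cdot>\<^sub>v (mat_adjoint W *\<^sub>v col W 0)"
      using n by (intro mult_mat_vec[of _ n n]) auto
    also have "mat_adjoint W *\<^sub>v col W 0 = col (mat_adjoint W * W) 0"
      using n by (simp add: col_mult2[of _ n n _ n])
    also have "\<dots> = unit_vec n 0"
      using W n by (simp add: unitary_mat_def)
    finally show ?thesis .
  qed
  have A'0: "A' $$ (i, 0) = (if i = 0 then e else 0)" if "i < n" for i
    using arg_cong[OF col0, of "\<lambda>v. v $ i"] that n carrier_matD[OF A'] by auto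
  have A'0': "A' $$ (0, j) = 0" if "j < n" "j \<noteq> 0" for j
  proof -
    have "A' $$ (0, j) = cnj (A' $$ (j, 0))"
      using that n carrier_matD[OF A'] by (subst herm[symmetric]) simp
    then show ?thesis using A'0[of j] that by simp
  qed
  define A3 where "A3 = Matrix.mat m m (\<lambda>(i, j). A' $$ (Suc i, Suc j))"
  have A3 [simp]: "A3 \<in> carrier_mat m m" by (simp add: A3_def)
  define E where "E = (Matrix.mat 1 1 (\<lambda>_. e) :: complex mat)"
  have E [simp]: "E \<in> carrier_mat 1 1" by (simp add: E_def)
  have block: "A' = four_block_mat E (0\<^sub>m 1 m) (0\<^sub>m m 1) A3"
    using carrier_matD[OF A'] m A'0 A'0' by (intro eq_matI) (auto simp: A3_def E_def)
  have herm3: "mat_adjoint A3 = A3"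
  proof (rule eq_matI)
    fix i j assume "i < dim_row A3" "j < dim_col A3"
    then have i: "i < m" and j: "j < m" by (auto simp: A3_def)
    have "cnj (A' $$ (Suc j, Suc i)) = mat_adjoint A' $$ (Suc i, Suc j)"
      using i j m carrier_matD[OF A'] by simp
    then show "mat_adjoint A3 $$ (i, j) = A3 $$ (i, j)"
      using i j herm by (simp add: A3_def)
  qed (auto simp: A3_def)
  have "similar_mat A' A"
    unfolding similar_mat_def using W A'
    by (intro exI[of _ "mat_adjoint W"] exI[of _ W] similar_mat_witI[of "mat_adjoint W" W n A' A])
      (simp_all add: A'_def unitary_mat_def)
  then have "char_poly A' = char_poly A" by (rule char_poly_similar)
  also have "char_poly A' = char_poly E * char_poly A3"
    unfolding block by (rule char_poly_four_block_zeros_col[OF E _ A3]) simp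
  also have "char_poly E = [:- e, 1:]"
    by (simp add: E_def char_poly_defs det_def sign_def)
  finally have "char_poly A3 = (\<Prod>e\<leftarrow>es. [:- e, 1:])"
    by (simp only: cp mult_cancel_left) simp
  from Cons.IH[OF A3 herm3 this] obtain U3 where U3: "unitary_mat m U3"
    and diag3: "mat_adjoint U3 * A3 * U3 = mat_diag m (\<lambda>i. es ! i)" by blast
  have U3' [simp]: "U3 \<in> carrier_mat m m" using U3 by (rule unitary_mat_carrier)
  define F where "F = four_block_mat (1\<^sub>m 1) (0\<^sub>m 1 m) (0\<^sub>m m 1) U3"
  have F [simp]: "F \<in> carrier_mat n n"
    unfolding F_def m using four_block_carrier_mat[of "1\<^sub>m 1" 1 1 U3 m m] by simp
  have adjF: "mat_adjoint F = four_block_mat (1\<^sub>m 1) (0\<^sub>m 1 m) (0\<^sub>m m 1) (mat_adjoint U3)"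
    using carrier_matD[OF U3'] by (intro eq_matI) (auto simp: F_def)
  have mult: "four_block_mat X (0\<^sub>m 1 m) (0\<^sub>m m 1) Y * four_block_mat X' (0\<^sub>m 1 m) (0\<^sub>m m 1) Y' =
      four_block_mat (X * X') (0\<^sub>m 1 m) (0\<^sub>m m 1) (Y * Y')"
    if "X \<in> carrier_mat 1 1" "X' \<in> carrier_mat 1 1" "Y \<in> carrier_mat m m" "Y' \<in> carrier_mat m m"
    for X Y X' Y' :: "complex mat"
    using mult_four_block_mat[OF that(1) zero_carrier_mat zero_carrier_mat that(3)
        that(2) zero_carrier_mat zero_carrier_mat that(4)]
      right_add_zero_mat[OF mult_carrier_mat[OF that(1,2)]]
      left_add_zero_mat[OF mult_carrier_mat[OF that(3,4)]]
      carrier_matD[OF that(1)] carrier_matD[OF that(2)] carrier_matD[OF that(3)] carrier_matD[OF that(4)]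
    by simp
  have "unitary_mat n F"
    using U3
    by (intro unitary_matI F) (simp only: adjF, simp add: F_def mult unitary_mat_def m plus_1_eq_Suc del: One_nat_def)
  then have U: "unitary_mat n (W * F)" using W by (intro unitary_mat_mult)
  have "mat_adjoint (W * F) * A * (W * F) = mat_adjoint F * A' * F"
    by (simp add: A'_def mat_adjoint_mult[of _ n n _ n] assoc_mult_mat[of _ n n _ n _ n] mult_carrier_mat[of _ n n _ n])
  also have "\<dots> = four_block_mat E (0\<^sub>m 1 m) (0\<^sub>m m 1) (mat_diag m (\<lambda>i. es ! i))"
    by (simp only: adjF block) (simp add: F_def mult diag3 left_mult_one_mat[OF E]
        right_mult_one_mat[OF E] mult_carrier_mat[of _ m m _ m] del: One_nat_def)
  also have "\<dots> = mat_diag n (\<lambda>i. (e # es) ! i)"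
    by (intro eq_matI) (auto simp: mat_diag_def m E_def nth_Cons')
  finally show ?case using U by blast
qed

lemma hermitian_diagonalization:
  fixes A :: "complex mat"
  assumes A: "A \<in> carrier_mat n n" and herm: "mat_adjoint A = A"
  shows "\<exists>U g. unitary_mat n U \<and> (\<forall>i j. i \<le> j \<and> j < n \<longrightarrow> g j \<le> g i) \<and>
    mat_adjoint U * A * U = mat_diag n (\<lambda>i. complex_of_real (g i))"
proof -
  obtain as where as: "char_poly A = (\<Prod>a\<leftarrow>as. [:- a, 1:])" and len: "length as = n"
    using char_poly_factorized[OF A] by blast
  \<comment> \<open>The key is a real part because the eigenvalues are known to be real only after
    the diagonalisation; its sign turns the ascending sort into a decreasing spectrum.\<close>
  define es where "es = sort_key (\<lambda>z. - Re z) as"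
  have "mset (map (\<lambda>a. [:- a, 1:]) es) = mset (map (\<lambda>a. [:- a, 1:]) as)"
    by (simp add: es_def)
  then have "(\<Prod>e\<leftarrow>es. [:- e, 1:]) = (\<Prod>a\<leftarrow>as. [:- a, 1:])"
    by (metis prod_mset_prod_list)
  with as have "char_poly A = (\<Prod>e\<leftarrow>es. [:- e, 1:])" by simp
  from hermitian_diagonalization_char_poly[OF A herm this]
  obtain U where U: "unitary_mat n U"
    and diag: "mat_adjoint U * A * U = mat_diag n (\<lambda>i. es ! i)" by blast
  have U' [simp]: "U \<in> carrier_mat n n" using U by (rule unitary_mat_carrier)
  have "mat_adjoint (mat_adjoint U * A * U) = mat_adjoint U * A * U"
    using A by (simp add: mat_adjoint_mult[of _ n n _ n] herm assoc_mult_mat[of _ n n _ n _ n] mult_carrier_mat[of _ n n _ n])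
  then have d: "mat_diag n (\<lambda>i. cnj (es ! i)) = mat_diag n (\<lambda>i. es ! i)"
    by (simp add: diag mat_adjoint_mat_diag)
  have "cnj (es ! i) = es ! i" if "i < n" for i
    using arg_cong[OF d, of "\<lambda>M. M $$ (i, i)"] that by (simp add: mat_diag_def)
  then have real: "es ! i = complex_of_real (Re (es ! i))" if "i < n" for i
    using that by (metis Reals_cnj_iff of_real_Re)
  have "mat_diag n (\<lambda>i. es ! i) = mat_diag n (\<lambda>i. complex_of_real (Re (es ! i)))"
    using real by (intro eq_matI) (auto simp: mat_diag_def)
  moreover have "Re (es ! j) \<le> Re (es ! i)" if "i \<le> j" "j < n" for i j
    using sorted_nth_mono[OF sorted_sort_key[of "\<lambda>z. - Re z" as], of i j] that len
    by (simp add: es_def)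
  ultimately show ?thesis using U diag
    by (intro exI[of _ U] exI[of _ "\<lambda>i. Re (es ! i)"]) auto
qed

section \<open>Weighted Gram determinants\<close>

text \<open>Cauchy--Binet, with the sum over row subsets replaced by a sum over all row selections;
  each subset is then counted \<open>k!\<close> times.\<close>

lemma det_weighted_gram:
  fixes C :: "nat \<Rightarrow> nat \<Rightarrow> complex" and d :: "nat \<Rightarrow> complex" and k K :: nat
  defines "F \<equiv> {f. (\<forall>i\<in>{0..<k}. f i \<in> {0..<K}) \<and> (\<forall>i. i \<notin> {0..<k} \<longrightarrow> f i = i)}"
  shows "of_nat (fact k) * det (Matrix.mat k k (\<lambda>(i, j). \<Sum>l<K. d l * (cnj (C l i) * C l j))) =
    (\<Sum>f\<in>F. (\<Prod>i=0..<k. d (f i)) *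
      (det (Matrix.mat k k (\<lambda>(i, j). C (f i) j)) * cnj (det (Matrix.mat k k (\<lambda>(i, j). C (f i) j)))))"
proof -
  define v where "v l = Matrix.vec k (C l)" for l
  define D where "D f = det (Matrix.mat k k (\<lambda>(i, j). C (f i) j))" for f :: "nat \<Rightarrow> nat"
  let ?P = "{p. p permutes {0..<k}}"
  define G where "G = Matrix.mat k k (\<lambda>(i, j). \<Sum>l<K. d l * (cnj (C l i) * C l j))"
  have vc [simp]: "v l \<in> carrier_vec k" for l by (simp add: v_def)
  have rows: "det (mat\<^sub>r k k (\<lambda>i. v (f i))) = D f" for f
    unfolding D_def by (intro arg_cong[of _ _ det] eq_matI) (auto simp: v_def)
  \<comment> \<open>Each row of \<open>G\<close> is a linear combination of the vectors
    \<open>v l\<close>, so multilinearity of the determinant expands it over all ways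
    \<open>f\<close> of selecting one vector per row.\<close>
  have "G = mat\<^sub>r k k (\<lambda>i. finsum_vec TYPE(complex) k (\<lambda>l. (d l * cnj (C l i)) \<cdot>\<^sub>v v l) {0..<K})"
    by (intro eq_matI)
      (auto simp: G_def index_finsum_vec v_def atLeast0LessThan mult.assoc)
  then have "det G = (\<Sum>f\<in>F. det (mat\<^sub>r k k (\<lambda>i. (d (f i) * cnj (C (f i) i)) \<cdot>\<^sub>v v (f i))))"
    unfolding F_def by (simp only:) (rule det_linear_rows_sum, auto)
  also have "\<dots> = (\<Sum>f\<in>F. (\<Prod>i=0..<k. d (f i) * cnj (C (f i) i)) * D f)"
    by (intro sum.cong refl) (subst det_rows_mul, auto simp: rows)
  finally have G: "det G = (\<Sum>f\<in>F. (\<Prod>i=0..<k. d (f i) * cnj (C (f i) i)) * D f)" .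
  \<comment> \<open>Composition with a permutation is a bijection on the selections. It leaves the
    product of the weights unchanged and multiplies \<open>D f\<close> by the sign.\<close>
  have reindex: "det G = (\<Sum>f\<in>F. (\<Prod>i=0..<k. d (f i)) * (signof p * (\<Prod>i=0..<k. cnj (C (f (p i)) i)) * D f))"
    if p: "p permutes {0..<k}" for p
  proof -
    have p_less: "p i < k" if "i < k" for i
      using permutes_in_image[OF p, of i] that by simp
    have Dp: "D (f \<circ> p) = signof p * D f" for f
      unfolding D_def
      by (subst det_permute_rows[OF _ p, symmetric, of "Matrix.mat k k (\<lambda>(i, j). C (f i) j)"])
        (auto intro!: arg_cong[of _ _ det] eq_matI simp: p_less)
    have prod_p: "(\<Prod>i=0..<k. d (f (p i)) * cnj (C (f (p i)) i)) =
        (\<Prod>i=0..<k. d (f i)) * (\<Prod>i=0..<k. cnj (C (f (p i)) i))" for f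
      using prod.permute[OF p, of "\<lambda>i. d (f i)"] by (simp add: prod.distrib o_def)
    have "det G = (\<Sum>f\<in>F. (\<Prod>i=0..<k. d (f (p i)) * cnj (C (f (p i)) i)) * D (f \<circ> p))"
      unfolding G
    proof (rule sum.reindex_bij_witness[where i = "\<lambda>f. f \<circ> p" and j = "\<lambda>f. f \<circ> Hilbert_Choice.inv p"])
      show "f \<circ> p \<in> F" if "f \<in> F" for f
        using that permutes_in_image[OF p] permutes_not_in[OF p] by (auto simp: F_def)
      show "f \<circ> Hilbert_Choice.inv p \<in> F" if "f \<in> F" for f
        using that permutes_in_image[OF permutes_inv[OF p]] permutes_not_in[OF permutes_inv[OF p]]
        by (auto simp: F_def)
    qed (auto simp: o_assoc[symmetric] permutes_inv_o[OF p] permutes_inverses[OF p])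
    also have "\<dots> = (\<Sum>f\<in>F. (\<Prod>i=0..<k. d (f i)) * (signof p * (\<Prod>i=0..<k. cnj (C (f (p i)) i)) * D f))"
      by (simp add: Dp prod_p mult_ac)
    finally show ?thesis .
  qed
  have cnjD: "(\<Sum>p\<in>?P. signof p * (\<Prod>i=0..<k. cnj (C (f (p i)) i))) = cnj (D f)" for f
  proof -
    have "D f = (\<Sum>p\<in>?P. signof p * (\<Prod>i=0..<k. C (f (p i)) i))"
      unfolding D_def
      by (subst det_col[of _ k])
        (auto intro!: sum.cong prod.cong dest: permutes_in_image[THEN iffD2])
    then show ?thesis by (simp add: sign_def)
  qed
  \<comment> \<open>Adding up these \<open>k!\<close> expressions for \<open>det G\<close> collects,
    for each selection, exactly the Leibniz expansion of \<open>cnj (D f)\<close>.\<close>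
  have "of_nat (fact k) * det G = (\<Sum>p\<in>?P. det G)"
    by (simp add: card_permutations[of "{0..<k}" k])
  also have "\<dots> = (\<Sum>p\<in>?P. \<Sum>f\<in>F. (\<Prod>i=0..<k. d (f i)) *
      (signof p * (\<Prod>i=0..<k. cnj (C (f (p i)) i)) * D f))"
    using reindex by (intro sum.cong refl) simp
  also have "\<dots> = (\<Sum>f\<in>F. \<Sum>p\<in>?P. (\<Prod>i=0..<k. d (f i)) *
      (signof p * (\<Prod>i=0..<k. cnj (C (f (p i)) i)) * D f))"
    by (rule sum.swap)
  also have "\<dots> = (\<Sum>f\<in>F. (\<Prod>i=0..<k. d (f i)) * (D f * cnj (D f)))"
    by (simp only: sum_distrib_left[symmetric] sum_distrib_right[symmetric] cnjD mult.commute[of "D _"])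
  finally show ?thesis by (simp add: G_def D_def)
qed

text \<open>Listed increasingly, \<open>k\<close> distinct naturals
  \<open>xs ! 0, xs ! 1, ...\<close> satisfy \<open>i \<le> xs ! i\<close>, so each selected weight
  is at most the one it is compared with.\<close>

lemma prod_selection_le:
  fixes d :: "nat \<Rightarrow> real"
  assumes inj: "inj_on f {0..<k}" and range: "f ` {0..<k} \<subseteq> {0..<K}"
    and nonneg: "\<And>i. i < K \<Longrightarrow> 0 \<le> d i" and anti: "\<And>i j. i \<le> j \<Longrightarrow> j < K \<Longrightarrow> d j \<le> d i"
  shows "(\<Prod>i=0..<k. d (f i)) \<le> (\<Prod>i<k. d i)"
proof -
  define S where "S = f ` {0..<k}"
  have S: "finite S" "card S = k" "S \<subseteq> {0..<K}"
    using inj range by (auto simp: S_def card_image)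
  define xs where "xs = sorted_list_of_set S"
  have xs: "set xs = S" "distinct xs" "length xs = k" "sorted_wrt (<) xs"
    using S by (auto simp: xs_def)
  have "(\<Prod>i=0..<k. d (f i)) = prod d S"
    unfolding S_def using inj by (simp add: prod.reindex)
  also have "\<dots> = (\<Prod>i<k. d (xs ! i))"
    using xs bij_betw_nth[OF xs(2), of "{..<k}" S]
    by (intro prod.reindex_bij_betw[symmetric]) auto
  also have "\<dots> \<le> (\<Prod>i<k. d i)"
  proof (intro prod_mono conjI)
    fix i assume "i \<in> {..<k}"
    then have i: "i < k" by simp
    have mem: "xs ! i < K" using S xs i nth_mem[of i xs] by auto
    then show "0 \<le> d (xs ! i)" by (rule nonneg)
    have "i \<le> xs ! i" using i
    proof (induction i)
      case (Suc i)
      then show ?case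
        using sorted_wrt_nth_less[OF xs(4), of i "Suc i"] xs(3) by simp
    qed simp
    then show "d (xs ! i) \<le> d i" using mem by (rule anti)
  qed
  finally show ?thesis .
qed

text \<open>Both determinants expand over the same selections with the nonnegative terms
  \<open>(cmod (D f))\<^sup>2\<close>. A selection that is not injective repeats a row and
  contributes nothing; for the others the weight is at most the product of the \<open>k\<close>
  largest. The complex order also records that both sides are real.\<close>

lemma det_weighted_gram_le:
  fixes C :: "nat \<Rightarrow> nat \<Rightarrow> complex" and d :: "nat \<Rightarrow> real"
  assumes nonneg: "\<And>i. i < K \<Longrightarrow> 0 \<le> d i" and anti: "\<And>i j. i \<le> j \<Longrightarrow> j < K \<Longrightarrow> d j \<le> d i"
  shows "det (Matrix.mat k k (\<lambda>(i, j). \<Sum>l<K. complex_of_real (d l) * (cnj (C l i) * C l j))) \<le>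
    complex_of_real (\<Prod>i<k. d i) * det (Matrix.mat k k (\<lambda>(i, j). \<Sum>l<K. cnj (C l i) * C l j))"
    (is "?L \<le> _ * ?R")
proof -
  define F where "F = {f. (\<forall>i\<in>{0..<k}. f i \<in> {0..<K}) \<and> (\<forall>i. i \<notin> {0..<k} \<longrightarrow> f i = i)}"
  define D where "D f = det (Matrix.mat k k (\<lambda>(i, j). C (f i) j))" for f :: "nat \<Rightarrow> nat"
  have L: "of_nat (fact k) * ?L =
      complex_of_real (\<Sum>f\<in>F. (\<Prod>i=0..<k. d (f i)) * (cmod (D f))\<^sup>2)"
    using det_weighted_gram[of k "\<lambda>l. complex_of_real (d l)" C K, folded F_def D_def]
    by (simp add: complex_norm_square del: of_real_power)
  have R: "of_nat (fact k) * ?R = complex_of_real (\<Sum>f\<in>F. (cmod (D f))\<^sup>2)"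
    using det_weighted_gram[of k "\<lambda>l. 1" C K, folded F_def D_def]
    by (simp add: complex_norm_square del: of_real_power)
  have "(\<Sum>f\<in>F. (\<Prod>i=0..<k. d (f i)) * (cmod (D f))\<^sup>2) \<le>
      (\<Sum>f\<in>F. (\<Prod>i<k. d i) * (cmod (D f))\<^sup>2)"
  proof (rule sum_mono)
    fix f assume f: "f \<in> F"
    show "(\<Prod>i=0..<k. d (f i)) * (cmod (D f))\<^sup>2 \<le> (\<Prod>i<k. d i) * (cmod (D f))\<^sup>2"
    proof (cases "inj_on f {0..<k}")
      case True
      show ?thesis
        by (rule mult_right_mono, rule prod_selection_le[OF True _ nonneg anti])
          (use f in \<open>auto simp: F_def\<close>)
    next
      case False
      then obtain i j where "f i = f j" "i \<noteq> j" "i < k" "j < k" by (auto simp: inj_on_def)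
      then have "D f = 0"
        unfolding D_def by (intro det_identical_rows[of _ k i j]) auto
      then show ?thesis by simp
    qed
  qed
  then have "of_nat (fact k) * ?L \<le> of_nat (fact k) * (complex_of_real (\<Prod>i<k. d i) * ?R)"
    unfolding L mult.left_commute[of "of_nat (fact k)"] R
    by (simp only: of_real_mult[symmetric]) (simp add: less_eq_complex_def sum_distrib_left del: of_real_sum of_real_prod)
  moreover have "(0 :: complex) < of_nat (fact k)" by (simp add: less_complex_def)
  ultimately show ?thesis by (simp add: less_eq_complex_def)
qed

section \<open>Positive semidefinite matrices\<close>

lemma mat_trace_comm:
  fixes A B :: "'a::comm_semiring_0 mat"
  assumes "A \<in> carrier_mat m n" "B \<in> carrier_mat n m"
  shows "mat_trace (A * B) = mat_trace (B * A)"
proof -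
  have "mat_trace (A * B) = (\<Sum>i<m. \<Sum>j<n. A $$ (i, j) * B $$ (j, i))"
    using assms by (simp add: mat_trace_def scalar_prod_def atLeast0LessThan)
  also have "\<dots> = (\<Sum>j<n. \<Sum>i<m. B $$ (j, i) * A $$ (i, j))"
    by (subst sum.swap) (simp add: mult.commute)
  also have "\<dots> = mat_trace (B * A)"
    using assms by (simp add: mat_trace_def scalar_prod_def atLeast0LessThan)
  finally show ?thesis .
qed

text \<open>Both sides are the determinant of the block matrix with rows \<open>(1, - B)\<close> and \<open>(C, 1)\<close>.\<close>

lemma det_one_add_mult_comm:
  fixes B C :: "'a::idom mat"
  assumes B: "B \<in> carrier_mat m n" and C: "C \<in> carrier_mat n m"
  shows "det (1\<^sub>m m + B * C) = det (1\<^sub>m n + C * B)"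
proof -
  let ?L = "four_block_mat (1\<^sub>m m) (0\<^sub>m m n) C (1\<^sub>m n)"
  let ?R = "four_block_mat (1\<^sub>m m) (- B) (0\<^sub>m n m) (1\<^sub>m n + C * B)"
  let ?S = "four_block_mat (1\<^sub>m m + B * C) (- B) (0\<^sub>m n m) (1\<^sub>m n)"
  have BC: "B * C \<in> carrier_mat m m" and CB: "C * B \<in> carrier_mat n n"
    using B C by (auto intro: mult_carrier_mat)
  have L: "?L \<in> carrier_mat (m + n) (m + n)" and R: "?R \<in> carrier_mat (m + n) (m + n)"
    and S: "?S \<in> carrier_mat (m + n) (m + n)"
    using B C BC CB by (auto intro!: four_block_carrier_mat)
  have nB: "- B \<in> carrier_mat m n" using B by simp
  \<comment> \<open>The block matrix is factored as \<open>?L * ?R\<close> and as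
    \<open>?S * ?L\<close>. All three factors are block triangular and \<open>?L\<close> has
    determinant 1.\<close>
  have LR: "?L * ?R = four_block_mat (1\<^sub>m m) (- B) C (1\<^sub>m n)"
  proof -
    have "?L * ?R = four_block_mat (1\<^sub>m m * 1\<^sub>m m + 0\<^sub>m m n * 0\<^sub>m n m)
        (1\<^sub>m m * - B + 0\<^sub>m m n * (1\<^sub>m n + C * B))
        (C * 1\<^sub>m m + 1\<^sub>m n * 0\<^sub>m n m) (C * - B + 1\<^sub>m n * (1\<^sub>m n + C * B))"
      using B C BC CB by (intro mult_four_block_mat) auto
    also have "\<dots> = four_block_mat (1\<^sub>m m) (- B) C (1\<^sub>m n)"
      using B C BC CB carrier_matD[OF B] carrier_matD[OF C]
      by (intro arg_cong4[of _ _ _ _ _ _ _ _ four_block_mat] eq_matI) auto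
    finally show ?thesis .
  qed
  have SL: "?S * ?L = four_block_mat (1\<^sub>m m) (- B) C (1\<^sub>m n)"
  proof -
    have "?S * ?L = four_block_mat ((1\<^sub>m m + B * C) * 1\<^sub>m m + - B * C)
        ((1\<^sub>m m + B * C) * 0\<^sub>m m n + - B * 1\<^sub>m n)
        (0\<^sub>m n m * 1\<^sub>m m + 1\<^sub>m n * C) (0\<^sub>m n m * 0\<^sub>m m n + 1\<^sub>m n * 1\<^sub>m n)"
      using B C BC CB by (intro mult_four_block_mat) auto
    also have "\<dots> = four_block_mat (1\<^sub>m m) (- B) C (1\<^sub>m n)"
      using B C BC CB carrier_matD[OF B] carrier_matD[OF C]
      by (intro arg_cong4[of _ _ _ _ _ _ _ _ four_block_mat] eq_matI) auto
    finally show ?thesis .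
  qed
  have detL: "det ?L = 1"
    using C by (subst det_four_block_mat_upper_right_zero[of _ m _ n]) auto
  have "det ?R = det (1\<^sub>m n + C * B)"
    using nB CB by (subst det_four_block_mat_lower_left_zero[of _ m _ n]) auto
  moreover have "det ?S = det (1\<^sub>m m + B * C)"
    using nB BC by (subst det_four_block_mat_lower_left_zero[of _ m _ n]) auto
  moreover have "det ?L * det ?R = det ?S * det ?L"
    by (simp only: det_mult[OF L R, symmetric] det_mult[OF S L, symmetric] LR SL)
  ultimately show ?thesis using detL by simp
qed

section \<open>Closure properties and spectra of positive semidefinite matrices\<close>

lemma psd_mat_carrier: "psd_mat n A \<Longrightarrow> A \<in> carrier_mat n n"
  by (simp add: psd_mat_def)

lemma psd_mat_congruence:
  assumes Q: "psd_mat m Q" and B: "B \<in> carrier_mat m n"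
  shows "psd_mat n (mat_adjoint B * Q * B)"
  unfolding psd_mat_def
proof (intro conjI ballI)
  have Qc: "Q \<in> carrier_mat m m" and Qh: "mat_adjoint Q = Q"
    using Q by (auto simp: psd_mat_def)
  have B': "mat_adjoint B \<in> carrier_mat n m" using B by simp
  have QB: "Q * B \<in> carrier_mat m n" using Qc B by (rule mult_carrier_mat)
  have assoc: "mat_adjoint B * Q * B = mat_adjoint B * (Q * B)"
    using B' Qc B by (rule assoc_mult_mat)
  show "mat_adjoint B * Q * B \<in> carrier_mat n n"
    unfolding assoc using B' QB by (rule mult_carrier_mat)
  have "mat_adjoint (mat_adjoint B * (Q * B)) = mat_adjoint (Q * B) * B"
    using mat_adjoint_mult[OF B' QB] by simp
  also have "\<dots> = mat_adjoint B * Q * B"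
    using mat_adjoint_mult[OF Qc B] Qh by simp
  finally show "mat_adjoint (mat_adjoint B * Q * B) = mat_adjoint B * Q * B"
    by (simp add: assoc)
  fix v :: "complex vec" assume v: "v \<in> carrier_vec n"
  have Bv: "B *\<^sub>v v \<in> carrier_vec m" using B v by (rule mult_mat_vec_carrier)
  have "(mat_adjoint B * Q * B) *\<^sub>v v = mat_adjoint B *\<^sub>v (Q *\<^sub>v (B *\<^sub>v v))"
    unfolding assoc using assoc_mult_mat_vec[OF B' QB v] assoc_mult_mat_vec[OF Qc B v] by simp
  then have "((mat_adjoint B * Q * B) *\<^sub>v v) \<bullet>c v = (Q *\<^sub>v (B *\<^sub>v v)) \<bullet>c (B *\<^sub>v v)"
    using mat_adjoint_inner[OF B' mult_mat_vec_carrier[OF Qc Bv] v] by simp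
  then show "0 \<le> ((mat_adjoint B * Q * B) *\<^sub>v v) \<bullet>c v"
    using Q Bv by (simp add: psd_mat_def)
qed

lemma psd_mat_add:
  assumes "psd_mat n A" "psd_mat n B"
  shows "psd_mat n (A + B)"
  using assms
  by (auto simp: psd_mat_def mat_adjoint_add[of _ n n] add_mult_distrib_mat_vec[of _ n n]
      add_scalar_prod_distrib[of _ n] mult_mat_vec_carrier[of _ n n])

lemma psd_mat_diag:
  assumes "\<And>i. i < n \<Longrightarrow> 0 \<le> d i"
  shows "psd_mat n (mat_diag n (\<lambda>i. complex_of_real (d i)))" (is "psd_mat n ?D")
  unfolding psd_mat_def
proof (intro conjI ballI)
  fix v :: "complex vec" assume v: "v \<in> carrier_vec n"
  have "(?D *\<^sub>v v) $ i = complex_of_real (d i) * v $ i" if "i < n" for i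
    using v that
    by (simp add: mat_diag_def scalar_prod_def if_distrib[of "\<lambda>x. x * _"] cong: if_cong)
  then have "(?D *\<^sub>v v) \<bullet>c v = (\<Sum>i<n. complex_of_real (d i * (cmod (v $ i))\<^sup>2))"
    using v by (simp add: scalar_prod_def atLeast0LessThan mult.assoc complex_norm_square
        del: of_real_power)
  also have "\<dots> = complex_of_real (\<Sum>i<n. d i * (cmod (v $ i))\<^sup>2)"
    by simp
  also have "0 \<le> \<dots>"
    using assms by (auto simp: less_eq_complex_def intro!: sum_nonneg simp del: of_real_sum)
  finally show "0 \<le> (?D *\<^sub>v v) \<bullet>c v" .
qed (auto simp: mat_adjoint_mat_diag)

lemma psd_mat_diag_entry:
  assumes "psd_mat n A" "i < n"
  shows "0 \<le> A $$ (i, i)"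
proof -
  have A: "A \<in> carrier_mat n n" using assms(1) by (rule psd_mat_carrier)
  have conj: "conjugate (unit_vec n i) = (unit_vec n i :: complex vec)"
    by (intro eq_vecI) (auto simp: unit_vec_def)
  have "(A *\<^sub>v unit_vec n i) \<bullet>c unit_vec n i = A $$ (i, i)"
    using A assms(2) by (simp add: conj)
  then show ?thesis
    using assms unfolding psd_mat_def by (metis unit_vec_carrier)
qed

lemma psd_mat_diagonalization:
  assumes "psd_mat n A"
  obtains U g where "unitary_mat n U" "\<And>i j. i \<le> j \<Longrightarrow> j < n \<Longrightarrow> g j \<le> g i"
    "\<And>i. i < n \<Longrightarrow> 0 \<le> g i"
    "mat_adjoint U * A * U = mat_diag n (\<lambda>i. complex_of_real (g i))"
proof -
  obtain U g where U: "unitary_mat n U" and anti: "\<forall>i j. i \<le> j \<and> j < n \<longrightarrow> g j \<le> g i"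
    and diag: "mat_adjoint U * A * U = mat_diag n (\<lambda>i. complex_of_real (g i))"
    using hermitian_diagonalization[of A n] assms by (auto simp: psd_mat_def)
  have "psd_mat n (mat_diag n (\<lambda>i. complex_of_real (g i)))"
    using psd_mat_congruence[OF assms unitary_mat_carrier[OF U]] by (simp add: diag)
  from psd_mat_diag_entry[OF this] have "0 \<le> g i" if "i < n" for i
    using that by (simp add: mat_diag_def less_eq_complex_def)
  with U anti diag show ?thesis by (intro that) auto
qed

lemma det_mat_diag: "det (mat_diag n f) = (\<Prod>i<n. f i)"
proof -
  have "det (mat_diag n f) = prod_list (diag_mat (mat_diag n f))"
    by (rule det_upper_triangular[of _ n]) (auto simp: mat_diag_def)
  also have "\<dots> = (\<Prod>i<n. f i)"
    by (simp add: diag_mat_def mat_diag_def prod.list_conv_set_nth atLeast0LessThan)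
  finally show ?thesis .
qed

lemma unitary_conj_det:
  assumes U: "unitary_mat n U" and A: "A \<in> carrier_mat n n"
  shows "det (mat_adjoint U * A * U) = det A"
proof -
  have Uc: "U \<in> carrier_mat n n" and Uc': "mat_adjoint U \<in> carrier_mat n n"
    and UU: "mat_adjoint U * U = 1\<^sub>m n"
    using U by (auto simp: unitary_mat_def)
  have "det (mat_adjoint U) * det U = 1"
    by (simp add: det_mult[OF Uc' Uc, symmetric] UU)
  then show ?thesis
    by (simp add: det_mult[OF mult_carrier_mat[OF Uc' A] Uc] det_mult[OF Uc' A])
qed

lemma unitary_conj_trace:
  assumes U: "unitary_mat n U" and A: "A \<in> carrier_mat n n"
  shows "mat_trace (mat_adjoint U * A * U) = mat_trace A"
proof -
  have Uc: "U \<in> carrier_mat n n" and Uc': "mat_adjoint U \<in> carrier_mat n n"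
    and UU: "U * mat_adjoint U = 1\<^sub>m n"
    using U by (auto simp: unitary_mat_def)
  have "mat_trace (mat_adjoint U * A * U) = mat_trace (U * (mat_adjoint U * A))"
    using mult_carrier_mat[OF Uc' A] Uc by (rule mat_trace_comm)
  also have "U * (mat_adjoint U * A) = A"
    using assoc_mult_mat[OF Uc Uc' A] A by (simp add: UU)
  finally show ?thesis .
qed

text \<open>On each eigenvalue the upper bound is x \<le> exp (x - 1), and nonnegativity allows
  these inequalities to be multiplied. It is the tangent bound of log det at the identity. Its right
  side sees \<open>Z\<close> only through the trace, so off-diagonal entries need no estimate
  later.\<close>

lemma psd_mat_det_bounds:
  assumes Z: "psd_mat n Z"
  shows "0 \<le> Re (det Z)" "Re (det Z) \<le> exp (Re (mat_trace Z) - real n)"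
proof -
  obtain U g where U: "unitary_mat n U" and g: "\<And>i. i < n \<Longrightarrow> 0 \<le> g i"
    and diag: "mat_adjoint U * Z * U = mat_diag n (\<lambda>i. complex_of_real (g i))"
    using psd_mat_diagonalization[OF Z] by metis
  have Zc: "Z \<in> carrier_mat n n" using Z by (rule psd_mat_carrier)
  have "det Z = (\<Prod>i<n. complex_of_real (g i))"
    using unitary_conj_det[OF U Zc] by (simp add: diag det_mat_diag)
  then have det: "Re (det Z) = (\<Prod>i<n. g i)"
    by (simp del: of_real_prod add: of_real_prod[symmetric])
  have "mat_trace Z = (\<Sum>i<n. complex_of_real (g i))"
    using unitary_conj_trace[OF U Zc] by (simp add: diag mat_trace_def mat_diag_def)
  then have tr: "Re (mat_trace Z) - real n = (\<Sum>i<n. g i - 1)"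
    by (simp add: sum_subtractf)
  show "0 \<le> Re (det Z)" unfolding det using g by (intro prod_nonneg) auto
  have "g i \<le> exp (g i - 1)" for i using exp_ge_add_one_self[of "g i - 1"] by simp
  then show "Re (det Z) \<le> exp (Re (mat_trace Z) - real n)"
    unfolding det tr using g by (auto simp: exp_sum intro!: prod_mono)
qed

section \<open>Water-filling\<close>

text \<open>Abel summation as an induction. The lower bound \<open>c\<close> is kept general because
  the step replaces it by the smallest weight \<open>a n\<close>, which then multiplies the shorter
  sum.\<close>

lemma sum_mult_antimono_ge:
  fixes a d :: "nat \<Rightarrow> real"
  assumes "\<And>i j. i \<le> j \<Longrightarrow> j < n \<Longrightarrow> a j \<le> a i"
    and "\<And>k. k \<le> n \<Longrightarrow> 0 \<le> (\<Sum>i<k. d i)" and "\<And>i. i < n \<Longrightarrow> c \<le> a i"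
  shows "c * (\<Sum>i<n. d i) \<le> (\<Sum>i<n. a i * d i)"
  using assms
proof (induction n arbitrary: c)
  case (Suc n)
  have "c * (\<Sum>i<Suc n. d i) \<le> a n * (\<Sum>i<Suc n. d i)"
    using Suc.prems(2)[of "Suc n"] Suc.prems(3)[of n] by (intro mult_right_mono) auto
  also have "\<dots> = a n * (\<Sum>i<n. d i) + a n * d n"
    by (simp add: distrib_left)
  also have "a n * (\<Sum>i<n. d i) \<le> (\<Sum>i<n. a i * d i)"
    using Suc.prems(1,2) by (intro Suc.IH) auto
  finally show ?case by simp
qed simp

text \<open>The value of \<open>ln (1 + g p) - p / \<mu>\<close> maximised over the power \<open>p \<ge> 0\<close>, as a function
  of \<open>x = \<mu> g\<close>.\<close>

definition wf_dual :: "real \<Rightarrow> real" where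
  "wf_dual x = ln (max 1 x) + 1 / max 1 x - 1"

lemma wf_dual_nonneg: "0 \<le> wf_dual x"
proof -
  define y where "y = max 1 x"
  have "0 < y" by (simp add: y_def)
  then have "- ln y \<le> 1 / y - 1" using ln_le_minus_one[of "1 / y"] by (simp add: ln_div)
  then show ?thesis by (simp add: wf_dual_def y_def)
qed

lemma wf_dual_eq_0: "x \<le> 1 \<Longrightarrow> wf_dual x = 0"
  by (simp add: wf_dual_def max_def)

text \<open>The left side is the supporting line, at ln y, of the convex function t -> wf_dual (exp
  t), whose slope there is 1 - 1 / y. For 1 \<le> z the claim reduces to ln w \<le> w - 1 at w = y /
  z; for z < 1 the line is already nonpositive.\<close>

lemma wf_dual_log_tangent:
  assumes y: "1 < y" and z: "0 < z"
  shows "wf_dual y + (1 - 1 / y) * (ln z - ln y) \<le> wf_dual z"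
proof (cases "1 \<le> z")
  case True
  have "ln (y / z) \<le> y / z - 1" using y z by (intro ln_le_minus_one) auto
  then have "(ln y - ln z) / y \<le> (y / z - 1) / y"
    using y z by (intro divide_right_mono) (auto simp: ln_div)
  then show ?thesis
    using y z True by (simp add: wf_dual_def max_def field_simps)
next
  case False
  have "(1 - 1 / y) * ln z \<le> 0"
    using y z False by (intro mult_nonneg_nonpos) auto
  moreover have "ln y / y \<le> (y - 1) / y"
    using y by (intro divide_right_mono ln_le_minus_one) auto
  moreover have "wf_dual y + (1 - 1 / y) * (ln z - ln y) =
      (1 - 1 / y) * ln z + (ln y / y - (y - 1) / y)"
    using y by (simp add: wf_dual_def max_def field_simps)
  ultimately have "wf_dual y + (1 - 1 / y) * (ln z - ln y) \<le> 0" by linarith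
  then show ?thesis using wf_dual_nonneg[of z] by linarith
qed

text \<open>Weak majorisation of the logarithms suffices because \<open>wf_dual\<close> is convex and
  nondecreasing in the logarithm of its argument.\<close>

lemma sum_wf_dual_mono:
  fixes x y :: "nat \<Rightarrow> real"
  assumes x: "\<And>i. i < n \<Longrightarrow> 0 \<le> x i" and anti: "\<And>i j. i \<le> j \<Longrightarrow> j < n \<Longrightarrow> x j \<le> x i"
    and y: "\<And>i. i < n \<Longrightarrow> 0 \<le> y i"
    and prods: "\<And>k. k \<le> n \<Longrightarrow> (\<Prod>i<k. x i) \<le> (\<Prod>i<k. y i)" and \<mu>: "0 < \<mu>"
  shows "(\<Sum>i<n. wf_dual (\<mu> * x i)) \<le> (\<Sum>i<n. wf_dual (\<mu> * y i))"
proof -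
  \<comment> \<open>The active channels, where \<open>wf_dual\<close> does not vanish. Logarithms
    are taken only here, since \<open>x\<close> and \<open>y\<close> may be 0 elsewhere. As
    \<open>x\<close> decreases, \<open>S\<close> is an initial segment, which is the shape that the
    hypothesis on products can address.\<close>
  define S where "S = {i. i < n \<and> 1 < \<mu> * x i}"
  define m where "m = card S"
  have down: "j \<in> S" if "i \<in> S" "j \<le> i" for i j
  proof -
    from that have i: "i < n" "1 < \<mu> * x i" by (auto simp: S_def)
    have "\<mu> * x i \<le> \<mu> * x j" using that i \<mu> by (intro mult_left_mono anti) auto
    with i have "1 < \<mu> * x j" by linarith
    with i that show ?thesis by (simp add: S_def)
  qed
  have finS: "finite S" by (simp add: S_def)
  have S: "S = {..<m}"
  proof -
    obtain t where t: "S = {..<t}"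
    proof (cases "S = {}")
      case True
      then show ?thesis using that[of 0] by simp
    next
      case False
      then have "S = {..<Suc (Max S)}"
        using down[OF Max_in[OF finS False]] Max_ge[OF finS] by (auto simp: less_Suc_eq_le)
      then show ?thesis by (rule that)
    qed
    then show ?thesis by (simp add: m_def)
  qed
  have mn: "m \<le> n"
  proof (rule ccontr)
    assume "\<not> m \<le> n"
    then have "n \<in> S" by (simp add: S)
    then show False by (simp add: S_def)
  qed
  have act: "1 < \<mu> * x i" if "i < m" for i
  proof -
    have "i \<in> S" unfolding S using that by simp
    then show ?thesis by (simp add: S_def)
  qed
  have inact: "\<mu> * x i \<le> 1" if "m \<le> i" "i < n" for i
  proof (rule ccontr)
    assume "\<not> ?thesis"
    with that have "i \<in> S" by (simp add: S_def)
    then show False unfolding S using that by simp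
  qed
  have xpos: "0 < x i" if "i < m" for i
    using act[OF that] \<mu> by (smt (verit) zero_less_mult_pos)
  \<comment> \<open>Positivity of the single \<open>y i\<close> is extracted from the product over
    all active indices, which dominates a positive product of \<open>x i\<close>.\<close>
  have "0 < (\<Prod>i<m. y i)"
    using prods[OF mn] prod_pos[of "{..<m}" x] xpos by fastforce
  then have ypos: "0 < y i" if "i < m" for i
  proof -
    have "y i \<noteq> 0" using \<open>0 < (\<Prod>i<m. y i)\<close> prod_zero[of "{..<m}" y] that by fastforce
    then show ?thesis using y[of i] that mn by simp
  qed
  have sums: "0 \<le> (\<Sum>i<k. ln (\<mu> * y i) - ln (\<mu> * x i))" if "k \<le> m" for k
  proof -
    have pos: "0 < x i" "0 < y i" if "i \<in> {..<k}" for i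
      using that \<open>k \<le> m\<close> xpos ypos by auto
    have "(\<Sum>i<k. ln (\<mu> * y i) - ln (\<mu> * x i)) = (\<Sum>i<k. ln (y i)) - (\<Sum>i<k. ln (x i))"
      unfolding sum_subtractf[symmetric]
    proof (intro sum.cong refl)
      show "ln (\<mu> * y i) - ln (\<mu> * x i) = ln (y i) - ln (x i)" if "i \<in> {..<k}" for i
        using pos[OF that] \<mu> by (simp add: ln_mult)
    qed
    also have "\<dots> = ln (\<Prod>i<k. y i) - ln (\<Prod>i<k. x i)"
      using pos by (intro arg_cong2[of _ _ _ _ minus] ln_prod[symmetric]) fastforce+
    also have "0 \<le> \<dots>"
    proof -
      have "0 < (\<Prod>i<k. x i)" "(\<Prod>i<k. x i) \<le> (\<Prod>i<k. y i)"
        using prods[of k] that mn pos(1) by (fastforce intro!: prod_pos)+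
      then show ?thesis by (simp add: ln_mono)
    qed
    finally show ?thesis .
  qed
  have "(\<Sum>i<n. wf_dual (\<mu> * x i)) = (\<Sum>i<m. wf_dual (\<mu> * x i))"
    using mn inact by (intro sum.mono_neutral_right) (auto simp: wf_dual_eq_0)
  also have "\<dots> \<le> (\<Sum>i<m. wf_dual (\<mu> * x i)) +
      (\<Sum>i<m. (1 - 1 / (\<mu> * x i)) * (ln (\<mu> * y i) - ln (\<mu> * x i)))"
  \<comment> \<open>The tangent slopes are nonnegative and decrease with the index, so the
    nonnegative partial sums of the logarithmic differences suffice, although single differences may
    be negative.\<close>
  proof -
    have "0 * (\<Sum>i<m. ln (\<mu> * y i) - ln (\<mu> * x i)) \<le>
        (\<Sum>i<m. (1 - 1 / (\<mu> * x i)) * (ln (\<mu> * y i) - ln (\<mu> * x i)))"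
    proof (rule sum_mult_antimono_ge)
      show "1 - 1 / (\<mu> * x j) \<le> 1 - 1 / (\<mu> * x i)" if "i \<le> j" "j < m" for i j
        using that anti[of i j] mn xpos[of i] xpos[of j] \<mu> by (simp add: frac_le)
      show "0 \<le> 1 - 1 / (\<mu> * x i)" if "i < m" for i
        using act[OF that] by simp
    qed (use sums in auto)
    then show ?thesis by simp
  qed
  also have "\<dots> \<le> (\<Sum>i<m. wf_dual (\<mu> * y i))"
    unfolding sum.distrib[symmetric] using act ypos \<mu>
    by (intro sum_mono wf_dual_log_tangent) auto
  also have "\<dots> \<le> (\<Sum>i<n. wf_dual (\<mu> * y i))"
    using mn by (intro sum_mono2) (auto simp: wf_dual_nonneg)
  finally show ?thesis .
qed

section \<open>Water-filling powers and the water level\<close>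

lemma wf_power_nonneg: "0 \<le> wf_power sF sB noise \<mu> i"
  by (simp add: wf_power_def)

lemma wf_power_nonpos_level: "0 \<le> noise \<Longrightarrow> \<mu> \<le> 0 \<Longrightarrow> wf_power sF sB noise \<mu> i = 0"
proof -
  assume "0 \<le> noise" "\<mu> \<le> 0"
  moreover from this have "0 \<le> noise / ((sF i)\<^sup>2 * (sB i)\<^sup>2)" by simp
  ultimately have "\<mu> - noise / ((sF i)\<^sup>2 * (sB i)\<^sup>2) \<le> 0" by linarith
  then show ?thesis by (simp only: wf_power_def max_absorb1 if_cancel)
qed

text \<open>There is no duality gap on a single channel. With x = \<mu> g, where g is the gain
  divided by the noise power, an active channel has 1 + g p = x and p / \<mu> = 1 - 1 / x; an
  inactive one has p = 0 and x < 1.\<close>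

lemma ln_rate_wf_power:
  assumes "0 < noise" "0 < \<mu>"
  shows "ln (1 + (sF i)\<^sup>2 * (sB i)\<^sup>2 * (wf_power sF sB noise \<mu> i / noise)) =
    wf_power sF sB noise \<mu> i / \<mu> + wf_dual (\<mu> * ((sF i)\<^sup>2 * (sB i)\<^sup>2 / noise))"
proof (cases "sF i * sB i = 0")
  case True
  then show ?thesis by (auto simp: wf_power_def wf_dual_def)
next
  case False
  define g where "g = (sF i)\<^sup>2 * (sB i)\<^sup>2"
  have g: "0 < g" using False by (simp add: g_def)
  have p: "wf_power sF sB noise \<mu> i = max 0 (\<mu> - noise / g)"
    using False by (simp add: wf_power_def g_def)
  show ?thesis
  proof (cases "1 \<le> \<mu> * (g / noise)")
    case True
    then have "noise / g \<le> \<mu>" using g assms by (simp add: field_simps)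
    moreover have "1 + g * ((\<mu> - noise / g) / noise) = \<mu> * (g / noise)"
      using g assms by (simp add: field_simps)
    ultimately show ?thesis
      using True g assms unfolding g_def[symmetric] p
      by (simp add: wf_dual_def max_def) (simp add: field_simps)
  next
    case False
    then have "\<mu> < noise / g" using g assms by (simp add: field_simps)
    then show ?thesis
      using False unfolding g_def[symmetric] p by (simp add: wf_dual_def)
  qed
qed

lemma sum_ln_rate_wf_power:
  assumes "0 < noise" "0 < \<mu>" "(\<Sum>i<r. wf_power sF sB noise \<mu> i) = P"
  shows "(\<Sum>i<r. ln (1 + (sF i)\<^sup>2 * (sB i)\<^sup>2 * (wf_power sF sB noise \<mu> i / noise))) =
    P / \<mu> + (\<Sum>i<r. wf_dual (\<mu> * ((sF i)\<^sup>2 * (sB i)\<^sup>2 / noise)))"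
  unfolding assms(3)[symmetric] sum_divide_distrib sum.distrib[symmetric]
  using assms(1,2) by (intro sum.cong refl ln_rate_wf_power)

text \<open>The total power is continuous and nondecreasing in the level. It is constant 0 until the
  first channel fills, so strict growth is claimed only beyond a level whose total is the positive
  number \<open>P\<close>: some channel is then active and its power still increases.\<close>

lemma water_level_exists_unique:
  assumes noise: "0 < noise" and P: "0 < P" and active: "\<exists>i<r. sF i * sB i \<noteq> 0"
  shows "\<exists>!\<mu>. (\<Sum>i<r. wf_power sF sB noise \<mu> i) = P"
proof -
  define f where "f \<mu> = (\<Sum>i<r. wf_power sF sB noise \<mu> i)" for \<mu>
  obtain a where a: "a < r" "sF a * sB a \<noteq> 0" using active by blast
  \<comment> \<open>At this level the channel \<open>a\<close> alone receives the power
    \<open>P\<close>, which gives the upper end for the intermediate value theorem.\<close>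
  define u where "u = P + noise / ((sF a)\<^sup>2 * (sB a)\<^sup>2)"
  have "0 \<le> noise / ((sF a)\<^sup>2 * (sB a)\<^sup>2)" using noise by simp
  then have u: "0 \<le> u" using P unfolding u_def by linarith
  have "isCont (\<lambda>\<mu>. wf_power sF sB noise \<mu> i) \<mu>" for i \<mu>
  proof (cases "sF i * sB i = 0")
    case False
    then show ?thesis unfolding wf_power_def by (simp only: if_False) (intro continuous_intros)
  qed (auto simp: wf_power_def)
  then have "isCont f \<mu>" for \<mu>
    unfolding f_def by (intro isCont_sum) auto
  moreover have "f 0 \<le> P"
    using P noise by (simp add: f_def wf_power_nonpos_level)
  moreover have "P \<le> f u"
  proof -
    have "P = wf_power sF sB noise u a"
      using a P by (simp add: wf_power_def u_def)
    also have "\<dots> \<le> f u"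
      unfolding f_def using a by (intro member_le_sum) (auto simp: wf_power_nonneg)
    finally show ?thesis .
  qed
  ultimately obtain \<mu> where \<mu>: "f \<mu> = P"
    using IVT[of f 0 P u] u by auto
  have strict: "f x < f y" if "x < y" "f x = P" for x y
    unfolding f_def
  proof (intro sum_strict_mono_ex1)
    show "\<forall>i\<in>{..<r}. wf_power sF sB noise x i \<le> wf_power sF sB noise y i"
      using that by (auto simp: wf_power_def)
    obtain i where "i < r" and i: "0 < wf_power sF sB noise x i"
    proof -
      have "\<exists>i\<in>{..<r}. 0 < wf_power sF sB noise x i"
      proof (rule ccontr)
        assume "\<not> ?thesis"
        then have "f x \<le> 0" unfolding f_def by (intro sum_nonpos) (auto simp: not_less)
        then show False using P \<open>f x = P\<close> by simp
      qed
      then show thesis using that by blast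
    qed
    have "wf_power sF sB noise x i < wf_power sF sB noise y i"
      using i \<open>x < y\<close> by (auto simp: wf_power_def split: if_splits)
    with \<open>i < r\<close> show "\<exists>i\<in>{..<r}. wf_power sF sB noise x i < wf_power sF sB noise y i"
      by blast
  qed simp
  show ?thesis
  proof (rule ex1I[of _ \<mu>])
    show "(\<Sum>i<r. wf_power sF sB noise \<mu> i) = P" using \<mu> by (simp add: f_def)
    fix x assume "(\<Sum>i<r. wf_power sF sB noise x i) = P"
    then have "f x = P" by (simp add: f_def)
    then show "x = \<mu>"
      using strict[of x \<mu>] strict[of \<mu> x] \<mu> by (cases x \<mu> rule: linorder_cases) auto
  qed
qed

section \<open>The spectrum of the cascaded channel\<close>

lemma adjoint_mult_index:
  fixes Y :: "complex mat"
  assumes "Y \<in> carrier_mat K n" "i < n" "j < n"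
  shows "(mat_adjoint Y * Y) $$ (i, j) = (\<Sum>l<K. cnj (Y $$ (l, i)) * Y $$ (l, j))"
  using assms by (simp add: scalar_prod_def atLeast0LessThan)

lemma adjoint_diag_mult_index:
  fixes Y :: "complex mat"
  assumes Y: "Y \<in> carrier_mat K n" and ij: "i < n" "j < n"
  shows "(mat_adjoint Y * mat_diag K d * Y) $$ (i, j) =
    (\<Sum>l<K. d l * (cnj (Y $$ (l, i)) * Y $$ (l, j)))"
proof -
  have "mat_adjoint Y * mat_diag K d = Matrix.mat n K (\<lambda>(i, j). mat_adjoint Y $$ (i, j) * d j)"
    using Y by (intro mat_diag_mult_right) simp
  then show ?thesis
    using Y ij by (simp add: scalar_prod_def atLeast0LessThan mult_ac)
qed

text \<open>The leading minors on both sides are the weighted and the plain Gram determinant of the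
  first \<open>k\<close> columns of \<open>Y\<close>.\<close>

lemma leading_minor_le:
  fixes Y :: "complex mat" and d :: "nat \<Rightarrow> real"
  assumes Y: "Y \<in> carrier_mat K n" and k: "k \<le> n"
    and nonneg: "\<And>i. i < K \<Longrightarrow> 0 \<le> d i" and anti: "\<And>i j. i \<le> j \<Longrightarrow> j < K \<Longrightarrow> d j \<le> d i"
  shows "det (Matrix.mat k k (($$) (mat_adjoint Y * mat_diag K (\<lambda>i. complex_of_real (d i)) * Y))) \<le>
    complex_of_real (\<Prod>i<k. d i) * det (Matrix.mat k k (($$) (mat_adjoint Y * Y)))"
proof -
  have "Matrix.mat k k (($$) (mat_adjoint Y * mat_diag K (\<lambda>i. complex_of_real (d i)) * Y)) =
      Matrix.mat k k (\<lambda>(i, j). \<Sum>l<K. complex_of_real (d l) * (cnj (Y $$ (l, i)) * Y $$ (l, j)))"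
    using k adjoint_diag_mult_index[OF Y] by (intro eq_matI) auto
  moreover have "Matrix.mat k k (($$) (mat_adjoint Y * Y)) =
      Matrix.mat k k (\<lambda>(i, j). \<Sum>l<K. cnj (Y $$ (l, i)) * Y $$ (l, j))"
    using k adjoint_mult_index[OF Y] by (intro eq_matI) auto
  ultimately show ?thesis
    using det_weighted_gram_le[where K = K and k = k and d = d and C = "\<lambda>l i. Y $$ (l, i)"]
      nonneg anti by simp
qed

lemma leading_minor_mat_diag:
  assumes "k \<le> n"
  shows "det (Matrix.mat k k (($$) (mat_diag n f))) = (\<Prod>i<k. f i)"
proof -
  have "Matrix.mat k k (($$) (mat_diag n f)) = mat_diag k f"
    using assms by (intro eq_matI) (auto simp: mat_diag_def)
  then show ?thesis by (simp add: det_mat_diag)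
qed

section \<open>Gram matrices of singular value decompositions\<close>

lemma rect_diag_carrier [simp]: "rect_diag r c s \<in> carrier_mat r c"
  by (simp add: rect_diag_def)

lemma rect_diag_gram:
  "mat_adjoint (rect_diag r c s) * rect_diag r c s =
    mat_diag c (\<lambda>i. complex_of_real (if i < r then (s i)\<^sup>2 else 0))"
proof (rule eq_matI)
  fix i j
  assume "i < dim_row (mat_diag c (\<lambda>i. complex_of_real (if i < r then (s i)\<^sup>2 else 0)))"
    "j < dim_col (mat_diag c (\<lambda>i. complex_of_real (if i < r then (s i)\<^sup>2 else 0)))"
  then have ij: "i < c" "j < c" by (auto simp: mat_diag_def)
  then have "(mat_adjoint (rect_diag r c s) * rect_diag r c s) $$ (i, j) =
      (\<Sum>l<r. (if l = i then complex_of_real (s i) * (if l = j then complex_of_real (s l) else 0) else 0))"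
    unfolding adjoint_mult_index[OF rect_diag_carrier ij]
    by (intro sum.cong) (auto simp: rect_diag_def)
  then show "(mat_adjoint (rect_diag r c s) * rect_diag r c s) $$ (i, j) =
      mat_diag c (\<lambda>i. complex_of_real (if i < r then (s i)\<^sup>2 else 0)) $$ (i, j)"
    using ij by (auto simp: mat_diag_def power2_eq_square)
qed (auto simp: rect_diag_def mat_diag_def)

lemma svd_gram:
  assumes "is_svd r c A U s V"
  shows "mat_adjoint A * A =
    V * mat_diag c (\<lambda>i. complex_of_real (if i < r then (s i)\<^sup>2 else 0)) * mat_adjoint V"
proof -
  let ?R = "rect_diag r c s"
  have U: "U \<in> carrier_mat r r" and UU: "mat_adjoint U * U = 1\<^sub>m r"
    and V: "V \<in> carrier_mat c c" and A: "A = U * ?R * mat_adjoint V"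
    using assms by (auto simp: is_svd_def unitary_mat_def)
  have R: "?R \<in> carrier_mat r c" by simp
  have UR: "U * ?R \<in> carrier_mat r c" using U R by (rule mult_carrier_mat)
  have V': "mat_adjoint V \<in> carrier_mat c c" using V by simp
  have "mat_adjoint A = V * mat_adjoint (U * ?R)"
    unfolding A by (simp add: mat_adjoint_mult[OF UR V'])
  then have "mat_adjoint A * A = V * mat_adjoint (U * ?R) * (U * ?R * mat_adjoint V)"
    by (simp add: A)
  also have "\<dots> = V * (mat_adjoint (U * ?R) * (U * ?R)) * mat_adjoint V"
    using V V' UR by (simp add: assoc_mult_mat[of _ c r _ c _ c] assoc_mult_mat[of _ c c _ r _ c]
        assoc_mult_mat[of _ c c _ c _ c] mult_carrier_mat[of _ c r _ c] mult_carrier_mat[of _ r c _ c])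
  also have "mat_adjoint (U * ?R) * (U * ?R) = mat_adjoint ?R * ?R"
  proof -
    have "mat_adjoint (U * ?R) * (U * ?R) = mat_adjoint ?R * (mat_adjoint U * U) * ?R"
      using U R by (simp add: mat_adjoint_mult[OF U R] assoc_mult_mat[of _ c r _ r _ c]
          assoc_mult_mat[of _ r r _ r _ c] assoc_mult_mat[of _ c r _ r _ r] mult_carrier_mat[of _ r r _ c]
          mult_carrier_mat[of _ r r _ r])
    then show ?thesis using R by (simp add: UU right_mult_one_mat[of _ c r])
  qed
  finally show ?thesis by (simp only: rect_diag_gram)
qed

lemma svd_carrier: "is_svd r c A U s V \<Longrightarrow> A \<in> carrier_mat r c"
  unfolding is_svd_def unitary_mat_def
  by (elim conjE) (simp add: mult_carrier_mat[of _ r c _ c] mult_carrier_mat[of _ r r _ c])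

text \<open>A multiplicative majorisation (Horn) for the spectrum \<open>g\<close> of the Gram matrix of the
  cascade: \<open>\<Phi>\<close> is unitary, hence disappears from the Gram matrix once the squared singular values
  of \<open>HB\<close> have been replaced by their product.\<close>

lemma cascade_gram_prod_le:
  assumes F: "is_svd K N HF UF sF VF" and B: "is_svd M K HB UB sB VB"
    and dims: "N \<le> K" "M \<le> K" and \<Phi>: "unitary_mat K \<Phi>" and U: "unitary_mat N U"
    and c: "0 \<le> c"
    and diag: "mat_adjoint U * (complex_of_real c \<cdot>\<^sub>m (mat_adjoint (HB * \<Phi> * HF) * (HB * \<Phi> * HF))) * U =
      mat_diag N (\<lambda>i. complex_of_real (g i))"
    and k: "k \<le> N"
  shows "(\<Prod>i<k. g i) \<le> (\<Prod>i<k. if i < M then c * ((sF i)\<^sup>2 * (sB i)\<^sup>2) else 0)"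
proof -
  \<comment> \<open>\<open>mat_adjoint HB * HB\<close> has \<open>K\<close> eigenvalues but only
    \<open>M\<close> singular values are given. Padding by 0 keeps the sequence decreasing because
    these values are nonnegative.\<close>
  define \<beta> where "\<beta> i = (if i < M then (sB i)\<^sup>2 else 0)" for i
  define \<phi> where "\<phi> i = (sF i)\<^sup>2" for i
  define DB where "DB = mat_diag K (\<lambda>i. complex_of_real (\<beta> i))"
  define DF where "DF = mat_diag N (\<lambda>i. complex_of_real (\<phi> i))"
  have sF: "0 \<le> sF i" "i \<le> j \<Longrightarrow> j < N \<Longrightarrow> sF j \<le> sF i" if "i < N" for i j
    using F that dims by (auto simp: is_svd_def)
  have sB: "0 \<le> sB i" "i \<le> j \<Longrightarrow> j < M \<Longrightarrow> sB j \<le> sB i" if "i < M" for i j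
    using B that dims by (auto simp: is_svd_def)
  have \<beta>: "0 \<le> c * \<beta> i" "i \<le> j \<Longrightarrow> c * \<beta> j \<le> c * \<beta> i" for i j
    using sB c by (auto simp: \<beta>_def intro!: mult_left_mono power_mono)
  have \<phi>: "0 \<le> \<phi> i" "i \<le> j \<Longrightarrow> j < N \<Longrightarrow> \<phi> j \<le> \<phi> i" for i j
    using sF by (auto simp: \<phi>_def intro!: power_mono)
  have HF: "HF \<in> carrier_mat K N" and HB: "HB \<in> carrier_mat M K"
    using F B by (auto dest: svd_carrier)
  have \<Phi>c: "\<Phi> \<in> carrier_mat K K" and Uc: "U \<in> carrier_mat N N"
    using \<Phi> U by (auto dest: unitary_mat_carrier)
  have VB: "unitary_mat K VB" "VB \<in> carrier_mat K K" and VF: "unitary_mat N VF" "VF \<in> carrier_mat N N"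
    using F B by (auto simp: is_svd_def dest: unitary_mat_carrier)
  have GB: "mat_adjoint HB * HB = VB * DB * mat_adjoint VB"
    using svd_gram[OF B] by (simp add: DB_def \<beta>_def)
  have "(if i < K then (sF i)\<^sup>2 else 0) = \<phi> i" if "i < N" for i
    using that dims by (simp add: \<phi>_def)
  then have "mat_diag N (\<lambda>i. complex_of_real (if i < K then (sF i)\<^sup>2 else 0)) = DF"
    by (intro eq_matI) (auto simp: DF_def mat_diag_def)
  then have GF: "mat_adjoint HF * HF = VF * DF * mat_adjoint VF"
    using svd_gram[OF F] by simp
  define W where "W = mat_adjoint VB * \<Phi>"
  have W: "unitary_mat K W"
    unfolding W_def using VB \<Phi> by (intro unitary_mat_mult unitary_mat_adjoint) auto
  have Wc: "W \<in> carrier_mat K K" using W by (rule unitary_mat_carrier)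
  \<comment> \<open>\<open>Y\<close> is \<open>HF\<close> between the eigenbasis \<open>U\<close> of
    the cascade and the right singular basis of \<open>HB\<close>. The cascade becomes
    \<open>mat_adjoint Y * DB * Y\<close>, whereas \<Phi> cancels in
    \<open>mat_adjoint Y * Y\<close>. The latter equals \<open>mat_adjoint Z * DF * Z\<close> with
    \<open>Z\<close> unitary, so the minor bound can be applied a second time and ends at the
    identity.\<close>
  define Y where "Y = W * (HF * U)"
  define Z where "Z = mat_adjoint VF * U"
  have HFU: "HF * U \<in> carrier_mat K N" using HF Uc by (rule mult_carrier_mat)
  have Y: "Y \<in> carrier_mat K N" unfolding Y_def using Wc HFU by (rule mult_carrier_mat)
  have Z: "unitary_mat N Z"
    unfolding Z_def using VF U by (intro unitary_mat_mult unitary_mat_adjoint) auto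
  have Zc: "Z \<in> carrier_mat N N" using Z by (rule unitary_mat_carrier)
  have DBc: "DB \<in> carrier_mat K K" and DFc: "DF \<in> carrier_mat N N"
    by (auto simp: DB_def DF_def)
  note carr = Uc \<Phi>c HF HB VB(2) VF(2) DBc DFc Wc HFU
  note assoc = assoc_mult_mat[of _ N N _ K _ N] assoc_mult_mat[of _ N K _ K _ N]
    assoc_mult_mat[of _ N N _ N _ N] assoc_mult_mat[of _ N N _ K _ K] assoc_mult_mat[of _ N K _ K _ K]
    assoc_mult_mat[of _ K K _ K _ K] assoc_mult_mat[of _ K K _ K _ N] assoc_mult_mat[of _ N K _ N _ N]
    assoc_mult_mat[of _ M K _ K _ N] assoc_mult_mat[of _ M K _ N _ N] assoc_mult_mat[of _ K M _ K _ N]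
    assoc_mult_mat[of _ N K _ M _ N] assoc_mult_mat[of _ K K _ M _ N] assoc_mult_mat[of _ K K _ N _ N]
    assoc_mult_mat[of _ N N _ M _ N] assoc_mult_mat[of _ N M _ N _ N]
    mult_carrier_mat[of _ N N _ N] mult_carrier_mat[of _ K K _ N] mult_carrier_mat[of _ K K _ K]
    mult_carrier_mat[of _ N K _ N] mult_carrier_mat[of _ N K _ K] mult_carrier_mat[of _ M K _ N]
    mult_carrier_mat[of _ K N _ N] mult_carrier_mat[of _ K M _ N] mult_carrier_mat[of _ M N _ N]
    mult_carrier_mat[of _ N M _ N]
  have gram_A: "mat_adjoint (HB * \<Phi> * HF) * (HB * \<Phi> * HF) =
      mat_adjoint HF * (mat_adjoint \<Phi> * (mat_adjoint HB * HB * (\<Phi> * HF)))"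
    using carr by (simp add: assoc mat_adjoint_mult[of _ M K _ N] mat_adjoint_mult[of _ K K _ N]
        assoc_mult_mat[of _ K K _ M _ N] mult_carrier_mat[of _ M K _ K] assoc_mult_mat[of _ K M _ K _ N])
  have adjY: "mat_adjoint Y = mat_adjoint U * (mat_adjoint HF * (mat_adjoint \<Phi> * VB))"
    using carr
    by (simp add: Y_def W_def mat_adjoint_mult[of _ K K _ N] mat_adjoint_mult[of _ K K _ K]
        mat_adjoint_mult[of _ K N _ N] assoc)
  have "mat_adjoint U * (mat_adjoint (HB * \<Phi> * HF) * (HB * \<Phi> * HF)) * U =
      mat_adjoint Y * DB * Y"
    unfolding gram_A GB adjY unfolding Y_def W_def using carr by (simp add: assoc)
  moreover have "mat_adjoint U * (complex_of_real c \<cdot>\<^sub>m G) * U = complex_of_real c \<cdot>\<^sub>m (mat_adjoint U * G * U)"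
    if "G \<in> carrier_mat N N" for G
    using that Uc by (simp add: mult_smult_distrib[of _ N N _ N] mult_smult_assoc_mat[of _ N N _ N] assoc)
  ultimately have "mat_diag N (\<lambda>i. complex_of_real (g i)) = complex_of_real c \<cdot>\<^sub>m (mat_adjoint Y * DB * Y)"
    using carr by (simp add: diag[symmetric] gram_A assoc)
  also have "\<dots> = mat_adjoint Y * mat_diag K (\<lambda>i. complex_of_real (c * \<beta> i)) * Y"
  proof (rule eq_matI)
    fix i j
    assume "i < dim_row (mat_adjoint Y * mat_diag K (\<lambda>i. complex_of_real (c * \<beta> i)) * Y)"
      "j < dim_col (mat_adjoint Y * mat_diag K (\<lambda>i. complex_of_real (c * \<beta> i)) * Y)"
    then have ij: "i < N" "j < N" using Y by auto
    have "mat_adjoint Y * DB * Y \<in> carrier_mat N N"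
      using Y DBc by (simp add: assoc)
    then have "(complex_of_real c \<cdot>\<^sub>m (mat_adjoint Y * DB * Y)) $$ (i, j) =
        complex_of_real c * (mat_adjoint Y * DB * Y) $$ (i, j)"
      using ij by (intro index_smult_mat) auto
    then show "(complex_of_real c \<cdot>\<^sub>m (mat_adjoint Y * DB * Y)) $$ (i, j) =
        (mat_adjoint Y * mat_diag K (\<lambda>i. complex_of_real (c * \<beta> i)) * Y) $$ (i, j)"
      unfolding DB_def adjoint_diag_mult_index[OF Y ij]
      by (simp add: sum_distrib_left mult.assoc)
  qed (use Y in auto)
  finally have GY: "mat_diag N (\<lambda>i. complex_of_real (g i)) =
      mat_adjoint Y * mat_diag K (\<lambda>i. complex_of_real (c * \<beta> i)) * Y" .
  have "mat_adjoint Y * Y = mat_adjoint (HF * U) * (mat_adjoint W * W * (HF * U))"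
    unfolding Y_def mat_adjoint_mult[OF Wc HFU] using carr by (simp add: assoc)
  also have "mat_adjoint W * W = 1\<^sub>m K" using W by (simp add: unitary_mat_def)
  also have "mat_adjoint (HF * U) * (1\<^sub>m K * (HF * U)) = mat_adjoint U * (mat_adjoint HF * HF) * U"
    using carr by (simp add: mat_adjoint_mult[OF HF Uc] left_mult_one_mat[of _ K N] assoc)
  also have "\<dots> = mat_adjoint Z * DF * Z"
    unfolding GF Z_def using carr by (simp add: mat_adjoint_mult[of _ N N _ N] assoc)
  finally have YZ: "mat_adjoint Y * Y = mat_adjoint Z * DF * Z" .
  have ZZ: "mat_adjoint Z * Z = mat_diag N (\<lambda>i. 1)"
    using Z by (simp add: unitary_mat_def)
  have "complex_of_real (\<Prod>i<k. g i) = det (Matrix.mat k k (($$) (mat_diag N (\<lambda>i. complex_of_real (g i)))))"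
    using k by (simp add: leading_minor_mat_diag)
  also have "\<dots> \<le> complex_of_real (\<Prod>i<k. c * \<beta> i) * det (Matrix.mat k k (($$) (mat_adjoint Y * Y)))"
    unfolding GY using \<beta> by (intro leading_minor_le[OF Y k]) auto
  finally have 1: "complex_of_real (\<Prod>i<k. g i) \<le>
      complex_of_real (\<Prod>i<k. c * \<beta> i) * det (Matrix.mat k k (($$) (mat_adjoint Y * Y)))" .
  have "det (Matrix.mat k k (($$) (mat_adjoint Y * Y))) \<le>
      complex_of_real (\<Prod>i<k. \<phi> i) * det (Matrix.mat k k (($$) (mat_adjoint Z * Z)))"
    unfolding YZ DF_def using \<phi> by (intro leading_minor_le[OF Zc k]) auto
  also have "det (Matrix.mat k k (($$) (mat_adjoint Z * Z))) = 1"
    unfolding ZZ using k by (simp only: leading_minor_mat_diag) simp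
  finally have 2: "det (Matrix.mat k k (($$) (mat_adjoint Y * Y))) \<le> complex_of_real (\<Prod>i<k. \<phi> i)"
    by simp
  have "(\<Prod>i<k. g i) \<le> (\<Prod>i<k. c * \<beta> i) * Re (det (Matrix.mat k k (($$) (mat_adjoint Y * Y))))"
    using 1 by (simp add: less_eq_complex_def del: of_real_prod)
  also have "\<dots> \<le> (\<Prod>i<k. c * \<beta> i) * (\<Prod>i<k. \<phi> i)"
    using 2 \<beta> by (intro mult_left_mono prod_nonneg)
      (auto simp: less_eq_complex_def simp del: of_real_prod)
  also have "\<dots> = (\<Prod>i<k. if i < M then c * ((sF i)\<^sup>2 * (sB i)\<^sup>2) else 0)"
    unfolding prod.distrib[symmetric] by (intro prod.cong) (auto simp: \<beta>_def \<phi>_def)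
  finally show ?thesis .
qed

section \<open>The dual bound on the rate\<close>

text \<open>The tangent bound \<open>det Z \<le> exp (tr Z - n)\<close> is applied to the determinant in question after
  dividing out \<open>y i = max 1 (\<mu> * g i)\<close>, the value that its \<open>i\<close>-th diagonal entry has at the
  water-filling optimum.\<close>

lemma ln_det_le_wf_dual:
  assumes A: "A \<in> carrier_mat M N" and Q: "psd_mat N Q" and P: "Re (mat_trace Q) \<le> P"
    and \<mu>: "0 < \<mu>" and U: "unitary_mat N U" and g: "\<And>i. i < N \<Longrightarrow> 0 \<le> g i"
    and diag: "mat_adjoint U * (c \<cdot>\<^sub>m (mat_adjoint A * A)) * U = mat_diag N (\<lambda>i. complex_of_real (g i))"
  shows "ln (Re (det (1\<^sub>m M + c \<cdot>\<^sub>m (A * Q * mat_adjoint A)))) \<le> P / \<mu> + (\<Sum>i<N. wf_dual (\<mu> * g i))"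
proof -
  define S where "S = mat_diag N (\<lambda>i. complex_of_real (sqrt (g i)))"
  define G where "G = c \<cdot>\<^sub>m (mat_adjoint A * A)"
  \<comment> \<open>A square factor with \<open>L * mat_adjoint L = G\<close>. It replaces
    \<open>A\<close> and leads to an \<open>N\<close> by \<open>N\<close> matrix \<open>X\<close>
    whose diagonal entries are \<open>1 + g i * t i\<close>.\<close>
  define L where "L = U * S"
  define T where "T = mat_adjoint U * Q * U"
  define X where "X = 1\<^sub>m N + mat_adjoint L * Q * L"
  define y where "y i = max 1 (\<mu> * g i)" for i
  \<comment> \<open>Scaling by square roots on both sides keeps \<open>Z\<close> positive
    semidefinite, as the trace bound requires, and divides the i-th diagonal entry by
    \<open>y i\<close>.\<close>
  define D where "D = mat_diag N (\<lambda>i. complex_of_real (1 / sqrt (y i)))"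
  define Z where "Z = mat_adjoint D * X * D"
  have Uc: "U \<in> carrier_mat N N" and UU': "U * mat_adjoint U = 1\<^sub>m N"
    using U by (auto simp: unitary_mat_def)
  have U'c: "mat_adjoint U \<in> carrier_mat N N" using Uc by simp
  have Qc: "Q \<in> carrier_mat N N" using Q by (rule psd_mat_carrier)
  have Sc: "S \<in> carrier_mat N N" and Dc: "D \<in> carrier_mat N N" by (auto simp: S_def D_def)
  have adjS: "mat_adjoint S = S" and adjD: "mat_adjoint D = D"
    by (auto simp: S_def D_def mat_adjoint_mat_diag)
  have Lc: "L \<in> carrier_mat N N" unfolding L_def using Uc Sc by (rule mult_carrier_mat)
  have A'c: "mat_adjoint A \<in> carrier_mat N M" using A by simp
  have A'A: "mat_adjoint A * A \<in> carrier_mat N N" using A'c A by (rule mult_carrier_mat)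
  have Gc: "G \<in> carrier_mat N N" using A'A by (simp add: G_def)
  note N_simps = assoc_mult_mat[of _ N N _ N _ N] mult_carrier_mat[of _ N N _ N]
  have SS: "S * S = mat_adjoint U * G * U"
  proof -
    have "S * S = mat_diag N (\<lambda>i. complex_of_real (sqrt (g i)) * complex_of_real (sqrt (g i)))"
      by (simp add: S_def)
    also have "\<dots> = mat_diag N (\<lambda>i. complex_of_real (g i))"
      using g by (intro eq_matI) (auto simp: mat_diag_def simp flip: of_real_mult)
    finally show ?thesis by (simp add: G_def diag)
  qed
  have "L * mat_adjoint L = U * (S * S) * mat_adjoint U"
    using Uc Sc U'c by (simp add: L_def mat_adjoint_mult[OF Uc Sc] adjS N_simps)
  also have "\<dots> = (U * mat_adjoint U) * G * (U * mat_adjoint U)"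
    unfolding SS using Uc Gc U'c by (simp add: N_simps)
  also have "\<dots> = G"
    using Gc by (simp add: UU' left_mult_one_mat[OF Gc] right_mult_one_mat[OF Gc])
  finally have LL: "L * mat_adjoint L = G" .
  have QA': "Q * mat_adjoint A \<in> carrier_mat N M" using Qc A'c by (rule mult_carrier_mat)
  \<comment> \<open>The identity det (1 + B C) = det (1 + C B) is used twice: it brings the two
    factors \<open>A\<close> together so that they form \<open>G\<close>, and then separates the two
    factors \<open>L\<close> of \<open>G\<close> again.\<close>
  have "c \<cdot>\<^sub>m (A * Q * mat_adjoint A) = A * (c \<cdot>\<^sub>m (Q * mat_adjoint A))"
    by (simp add: assoc_mult_mat[OF A Qc A'c] mult_smult_distrib[OF A QA'])
  then have "det (1\<^sub>m M + c \<cdot>\<^sub>m (A * Q * mat_adjoint A)) =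
      det (1\<^sub>m N + c \<cdot>\<^sub>m (Q * mat_adjoint A) * A)"
    using det_one_add_mult_comm[OF A smult_carrier_mat[OF QA']] by simp
  also have "c \<cdot>\<^sub>m (Q * mat_adjoint A) * A = Q * (L * mat_adjoint L)"
    unfolding LL G_def using mult_smult_assoc_mat[OF QA' A] assoc_mult_mat[OF Qc A'c A]
      mult_smult_distrib[OF Qc A'A] by simp
  also have "Q * (L * mat_adjoint L) = (Q * L) * mat_adjoint L"
    using Qc Lc by (simp add: N_simps)
  also have "det (1\<^sub>m N + (Q * L) * mat_adjoint L) = det (1\<^sub>m N + mat_adjoint L * (Q * L))"
    using Qc Lc by (intro det_one_add_mult_comm[of _ N N]) (auto simp: N_simps)
  also have "\<dots> = det X"
    using Qc Lc by (simp add: X_def N_simps)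
  finally have detX: "det (1\<^sub>m M + c \<cdot>\<^sub>m (A * Q * mat_adjoint A)) = det X" .
  have psdLQL: "psd_mat N (mat_adjoint L * Q * L)" using Q Lc by (rule psd_mat_congruence)
  have "psd_mat N (1\<^sub>m N)"
    using psd_mat_diag[of N "\<lambda>_. 1"] by simp
  then have psdX: "psd_mat N X" unfolding X_def using psdLQL by (rule psd_mat_add)
  then have Xc: "X \<in> carrier_mat N N" by (rule psd_mat_carrier)
  have psdZ: "psd_mat N Z" unfolding Z_def using psdX Dc by (rule psd_mat_congruence)
  have psdT: "psd_mat N T" unfolding T_def using Q Uc by (rule psd_mat_congruence)
  then have Tc: "T \<in> carrier_mat N N" by (rule psd_mat_carrier)
  \<comment> \<open>The power that \<open>Q\<close> spends on the i-th eigenchannel; the change to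
    the basis \<open>U\<close> preserves the total.\<close>
  define t where "t i = Re (T $$ (i, i))" for i
  have t: "0 \<le> t i" if "i < N" for i
    using psd_mat_diag_entry[OF psdT that] by (simp add: t_def less_eq_complex_def)
  have "(\<Sum>i<N. t i) = Re (mat_trace T)"
    using Tc by (simp add: mat_trace_def t_def)
  then have sum_t: "(\<Sum>i<N. t i) \<le> P"
    using unitary_conj_trace[OF U Qc] P by (simp add: T_def)
  have y: "0 < y i" for i by (simp add: y_def)
  then have y0: "y i \<noteq> 0" for i by (metis less_irrefl)
  have STS: "mat_adjoint L * Q * L = S * T * S"
    using Uc Sc Qc U'c by (simp add: L_def T_def mat_adjoint_mult[OF Uc Sc] adjS N_simps)
  have X_entry: "Re (X $$ (i, i)) = 1 + g i * t i" if "i < N" for i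
  proof -
    have "(S * T * S) $$ (i, i) = complex_of_real (sqrt (g i)) * T $$ (i, i) * complex_of_real (sqrt (g i))"
      using that Tc unfolding S_def
      by (subst mat_diag_mult_right[of _ N N]) (auto simp: mat_diag_mult_left[of _ N N])
    also have "\<dots> = complex_of_real (g i) * T $$ (i, i)"
      using g[OF that] by (simp add: mult_ac flip: of_real_mult mult.assoc)
    finally show ?thesis
      using that carrier_matD[OF psd_mat_carrier[OF psdLQL]] by (simp add: X_def STS t_def)
  qed
  have Z_entry: "Re (Z $$ (i, i)) = (1 + g i * t i) / y i" if "i < N" for i
  proof -
    have "Z $$ (i, i) = complex_of_real (1 / sqrt (y i)) * X $$ (i, i) * complex_of_real (1 / sqrt (y i))"
      using that Xc unfolding Z_def adjD unfolding D_def
      by (subst mat_diag_mult_right[of _ N N]) (auto simp: mat_diag_mult_left[of _ N N])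
    also have "\<dots> = complex_of_real (1 / y i) * X $$ (i, i)"
      using y[of i] by (simp add: mult_ac flip: of_real_mult mult.assoc)
    finally show ?thesis using X_entry[OF that] by simp
  qed
  \<comment> \<open>Since \<open>y i\<close> is at least \<open>\<mu> * g i\<close>, each unit of
    power raises the trace by at most 1 / \<mu>, the same price on every channel.\<close>
  have bound: "(1 + g i * t i) / y i \<le> 1 / y i + t i / \<mu>" if "i < N" for i
  proof -
    have "g i / y i \<le> 1 / \<mu>"
      using \<mu> y[of i] by (simp add: field_simps) (simp add: y_def)
    then have "g i / y i * t i \<le> 1 / \<mu> * t i" using t[OF that] by (rule mult_right_mono)
    then show ?thesis by (simp add: add_divide_distrib)
  qed
  have "Re (mat_trace Z) = (\<Sum>i<N. (1 + g i * t i) / y i)"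
    using psd_mat_carrier[OF psdZ] Z_entry by (simp add: mat_trace_def)
  also have "\<dots> \<le> (\<Sum>i<N. 1 / y i + t i / \<mu>)"
    using bound by (intro sum_mono) auto
  also have "\<dots> = (\<Sum>i<N. 1 / y i) + (\<Sum>i<N. t i) / \<mu>"
    by (simp add: sum.distrib sum_divide_distrib)
  also have "\<dots> \<le> (\<Sum>i<N. 1 / y i) + P / \<mu>"
    using sum_t \<mu> by (intro add_left_mono divide_right_mono) auto
  finally have trZ: "Re (mat_trace Z) - real N \<le> P / \<mu> + (\<Sum>i<N. 1 / y i - 1)"
    by (simp add: sum_subtractf)
  have "det Z = complex_of_real (\<Prod>i<N. 1 / sqrt (y i)) * det X * complex_of_real (\<Prod>i<N. 1 / sqrt (y i))"
  proof -
    have "det D = complex_of_real (\<Prod>i<N. 1 / sqrt (y i))" by (simp add: D_def det_mat_diag)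
    then show ?thesis
      by (simp only: Z_def adjD det_mult[OF mult_carrier_mat[OF Dc Xc] Dc] det_mult[OF Dc Xc])
  qed
  also have "\<dots> = complex_of_real ((\<Prod>i<N. 1 / sqrt (y i)) * (\<Prod>i<N. 1 / sqrt (y i))) * det X"
    by (simp only: of_real_mult mult_ac)
  also have "(\<Prod>i<N. 1 / sqrt (y i)) * (\<Prod>i<N. 1 / sqrt (y i)) = (\<Prod>i<N. 1 / y i)"
    unfolding prod.distrib[symmetric] using y by (intro prod.cong) (auto simp: less_imp_le)
  finally have "Re (det Z) = (\<Prod>i<N. 1 / y i) * Re (det X)"
    by (simp del: of_real_prod)
  then have detZ: "Re (det Z) * (\<Prod>i<N. y i) = Re (det X)"
    using y by (simp add: prod_dividef less_imp_neq prod_zero_iff) (metis less_irrefl)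
  show ?thesis
  \<comment> \<open>As \<open>ln 0 = 0\<close> in HOL and the right side is nonnegative, the case 0
    can be settled directly, and nonnegativity of the determinant covers the rest.\<close>
  proof (cases "Re (det X) = 0")
    case True
    have "0 \<le> P" using sum_t t by (meson order_trans sum_nonneg lessThan_iff)
    then show ?thesis
      using \<mu> True by (simp add: detX wf_dual_nonneg sum_nonneg)
  next
    case False
    have yprod: "0 < (\<Prod>i<N. y i)" using y by (simp add: prod_pos)
    have "0 < Re (det X)" using False psd_mat_det_bounds(1)[OF psdX] by simp
    moreover from this have Zpos: "0 < Re (det Z)"
      using yprod unfolding detZ[symmetric] by (simp add: zero_less_mult_iff)
    ultimately have "ln (Re (det X)) = ln (Re (det Z)) + (\<Sum>i<N. ln (y i))"
      unfolding detZ[symmetric] using yprod y0 by (simp add: ln_mult ln_prod)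
    also have "ln (Re (det Z)) \<le> Re (mat_trace Z) - real N"
      using psd_mat_det_bounds(2)[OF psdZ] Zpos by (metis ln_exp ln_le_cancel_iff exp_gt_zero)
    also have "\<dots> + (\<Sum>i<N. ln (y i)) \<le> P / \<mu> + (\<Sum>i<N. 1 / y i - 1) + (\<Sum>i<N. ln (y i))"
      using trZ by simp
    also have "\<dots> = P / \<mu> + (\<Sum>i<N. wf_dual (\<mu> * g i))"
      unfolding add.assoc sum.distrib[symmetric]
      by (intro arg_cong2[of _ _ _ _ "(+)"] refl sum.cong) (simp add: wf_dual_def y_def)
    finally show ?thesis by (simp add: detX)
  qed
qed

lemma rate_eq: "H \<in> carrier_mat M N \<Longrightarrow> rate b noise H Q =
  ln (Re (det (1\<^sub>m M + complex_of_real (1 / noise) \<cdot>\<^sub>m (H * Q * mat_adjoint H)))) / ln b"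
  by (simp add: rate_def log_def)

text \<open>Weak duality for the joint problem: the right side mentions neither \<open>Q\<close> nor
  \<Phi>, so each \<mu> gives one bound for all feasible pairs.\<close>

lemma cascade_ln_det_le:
  assumes F: "is_svd K N HF UF sF VF" and B: "is_svd M K HB UB sB VB"
    and dims: "N \<le> K" "M \<le> K" and feas: "feasible N K P Q \<Phi>" and noise: "0 < noise" and \<mu>: "0 < \<mu>"
  shows "ln (Re (det (1\<^sub>m M + complex_of_real (1 / noise) \<cdot>\<^sub>m
      (HB * \<Phi> * HF * Q * mat_adjoint (HB * \<Phi> * HF))))) \<le>
    P / \<mu> + (\<Sum>i<min N M. wf_dual (\<mu> * ((sF i)\<^sup>2 * (sB i)\<^sup>2 / noise)))"
proof -
  define A where "A = HB * \<Phi> * HF"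
  define c where "c = 1 / noise"
  define G where "G = complex_of_real c \<cdot>\<^sub>m (mat_adjoint A * A)"
  \<comment> \<open>The claimed gains, extended by 0 to the length \<open>N\<close> of the spectrum
    of \<open>G\<close>; the added terms have \<open>wf_dual\<close> equal to 0 and are dropped at
    the end.\<close>
  define h where "h i = (if i < M then c * ((sF i)\<^sup>2 * (sB i)\<^sup>2) else 0)" for i
  have c: "0 \<le> c" using noise by (simp add: c_def)
  have \<Phi>c: "\<Phi> \<in> carrier_mat K K" and \<Phi>\<Phi>: "\<Phi> * mat_adjoint \<Phi> = 1\<^sub>m K"
    and Q: "psd_mat N Q" "Re (mat_trace Q) \<le> P"
    using feas by (auto simp: feasible_def)
  have \<Phi>: "unitary_mat K \<Phi>"
    using mat_mult_left_right_inverse[of \<Phi> K "mat_adjoint \<Phi>"] \<Phi>c \<Phi>\<Phi> by (simp add: unitary_mat_def)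
  have HF: "HF \<in> carrier_mat K N" and HB: "HB \<in> carrier_mat M K"
    using F B by (auto dest: svd_carrier)
  have A: "A \<in> carrier_mat M N"
    unfolding A_def using mult_carrier_mat[OF HB \<Phi>c] HF by (rule mult_carrier_mat)
  have "psd_mat M (mat_diag M (\<lambda>i. complex_of_real c))" using c by (rule psd_mat_diag)
  from psd_mat_congruence[OF this A] have "psd_mat N (mat_adjoint A * mat_diag M (\<lambda>i. complex_of_real c) * A)" .
  moreover have "mat_adjoint A * mat_diag M (\<lambda>i. complex_of_real c) * A = G"
  proof -
    have "mat_diag M (\<lambda>i. complex_of_real c) = complex_of_real c \<cdot>\<^sub>m 1\<^sub>m M"
      by (intro eq_matI) (auto simp: mat_diag_def)
    then have "mat_adjoint A * mat_diag M (\<lambda>i. complex_of_real c) = complex_of_real c \<cdot>\<^sub>m mat_adjoint A"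
      using mult_smult_distrib[of "mat_adjoint A" N M "1\<^sub>m M" M] A by (simp add: right_mult_one_mat[of _ N M])
    then show ?thesis
      unfolding G_def using mult_smult_assoc_mat[of "mat_adjoint A" N M A N] A by simp
  qed
  ultimately have "psd_mat N G" by simp
  then obtain U g where U: "unitary_mat N U" and anti: "\<And>i j. i \<le> j \<Longrightarrow> j < N \<Longrightarrow> g j \<le> g i"
    and g: "\<And>i. i < N \<Longrightarrow> 0 \<le> g i"
    and diag: "mat_adjoint U * G * U = mat_diag N (\<lambda>i. complex_of_real (g i))"
    using psd_mat_diagonalization by metis
  have prods: "(\<Prod>i<k. g i) \<le> (\<Prod>i<k. h i)" if "k \<le> N" for k
    unfolding h_def by (rule cascade_gram_prod_le[OF F B dims \<Phi> U c _ that])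
      (use diag in \<open>simp add: G_def A_def\<close>)
  have "ln (Re (det (1\<^sub>m M + complex_of_real c \<cdot>\<^sub>m (A * Q * mat_adjoint A)))) \<le>
      P / \<mu> + (\<Sum>i<N. wf_dual (\<mu> * g i))"
    using A Q \<mu> U g diag unfolding G_def by (rule ln_det_le_wf_dual)
  also have "(\<Sum>i<N. wf_dual (\<mu> * g i)) \<le> (\<Sum>i<N. wf_dual (\<mu> * h i))"
    using g anti prods \<mu> c by (intro sum_wf_dual_mono) (auto simp: h_def)
  also have "(\<Sum>i<N. wf_dual (\<mu> * h i)) = (\<Sum>i<min N M. wf_dual (\<mu> * h i))"
    by (intro sum.mono_neutral_right) (auto simp: h_def wf_dual_eq_0)
  also have "\<dots> = (\<Sum>i<min N M. wf_dual (\<mu> * ((sF i)\<^sup>2 * (sB i)\<^sup>2 / noise)))"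
    by (intro sum.cong) (auto simp: h_def c_def)
  finally show ?thesis by (simp add: A_def c_def)
qed

section \<open>Attainment\<close>

text \<open>The common diagonal has to pass through the inner dimension: an index below both
  \<open>M\<close> and \<open>N\<close> must also lie below \<open>K\<close>.\<close>

lemma rect_diag_mult:
  assumes "M \<le> K \<or> N \<le> K"
  shows "rect_diag M K s * rect_diag K N t = rect_diag M N (\<lambda>i. s i * t i)"
proof (rule eq_matI)
  fix i j assume "i < dim_row (rect_diag M N (\<lambda>i. s i * t i))" "j < dim_col (rect_diag M N (\<lambda>i. s i * t i))"
  then have ij: "i < M" "j < N" by (auto simp: rect_diag_def)
  then have "(rect_diag M K s * rect_diag K N t) $$ (i, j) =
      (\<Sum>l<K. rect_diag M K s $$ (i, l) * rect_diag K N t $$ (l, j))"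
    using carrier_matD[OF rect_diag_carrier] by (simp add: scalar_prod_def atLeast0LessThan)
  also have "\<dots> = (\<Sum>l<K. if l = i then complex_of_real (s i) * (if i = j then complex_of_real (t i) else 0) else 0)"
    using ij by (intro sum.cong) (auto simp: rect_diag_def)
  finally show "(rect_diag M K s * rect_diag K N t) $$ (i, j) = rect_diag M N (\<lambda>i. s i * t i) $$ (i, j)"
    using ij assms by (auto simp: rect_diag_def)
qed (auto simp: rect_diag_def)

lemma rect_diag_mult_mat_diag_adjoint:
  "rect_diag M N s * mat_diag N (\<lambda>i. complex_of_real (q i)) * mat_adjoint (rect_diag M N s) =
    mat_diag M (\<lambda>i. complex_of_real (if i < N then (s i)\<^sup>2 * q i else 0))"
proof (rule eq_matI)
  fix i j
  assume "i < dim_row (mat_diag M (\<lambda>i. complex_of_real (if i < N then (s i)\<^sup>2 * q i else 0)))"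
    "j < dim_col (mat_diag M (\<lambda>i. complex_of_real (if i < N then (s i)\<^sup>2 * q i else 0)))"
  then have ij: "i < M" "j < M" by (auto simp: mat_diag_def)
  have "(rect_diag M N s * mat_diag N (\<lambda>i. complex_of_real (q i)) * mat_adjoint (rect_diag M N s)) $$ (i, j) =
      (\<Sum>l<N. rect_diag M N s $$ (i, l) * complex_of_real (q l) * cnj (rect_diag M N s $$ (j, l)))"
    using ij carrier_matD[OF rect_diag_carrier] unfolding mat_diag_mult_right[OF rect_diag_carrier]
    by (simp add: scalar_prod_def atLeast0LessThan)
  also have "\<dots> = (\<Sum>l<N. if l = i then complex_of_real (s i * q i) * (if i = j then complex_of_real (s i) else 0) else 0)"
    using ij by (intro sum.cong) (auto simp: rect_diag_def)
  finally show "(rect_diag M N s * mat_diag N (\<lambda>i. complex_of_real (q i)) * mat_adjoint (rect_diag M N s)) $$ (i, j) =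
      mat_diag M (\<lambda>i. complex_of_real (if i < N then (s i)\<^sup>2 * q i else 0)) $$ (i, j)"
    using ij by (auto simp: mat_diag_def power2_eq_square)
qed (auto simp: rect_diag_def mat_diag_def)

lemma wf_covariance_feasible:
  assumes V: "unitary_mat N V" and \<Phi>: "unitary_mat K \<Phi>" and r: "r \<le> N"
    and p: "\<And>i. i < r \<Longrightarrow> 0 \<le> p i" and P: "(\<Sum>i<r. p i) \<le> P"
  shows "feasible N K P (wf_covariance r N V p) \<Phi>"
proof -
  define q where "q i = (if i < r then p i else 0)" for i
  have pd: "power_diag r N p = mat_diag N (\<lambda>i. complex_of_real (q i))"
    unfolding power_diag_def by (intro eq_matI) (auto simp: mat_diag_def q_def)
  have V': "unitary_mat N (mat_adjoint V)" using V by (rule unitary_mat_adjoint)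
  have cov: "wf_covariance r N V p =
      mat_adjoint (mat_adjoint V) * mat_diag N (\<lambda>i. complex_of_real (q i)) * mat_adjoint V"
    by (simp add: wf_covariance_def pd)
  have "psd_mat N (wf_covariance r N V p)"
    unfolding cov by (intro psd_mat_congruence[where m = N] psd_mat_diag unitary_mat_carrier[OF V'])
      (auto simp: q_def p)
  moreover have "mat_trace (wf_covariance r N V p) = complex_of_real (\<Sum>i<N. q i)"
    unfolding cov by (subst unitary_conj_trace[OF V']) (auto simp: mat_trace_def mat_diag_def)
  moreover have "(\<Sum>i<N. q i) = (\<Sum>i<r. p i)"
    using r by (intro sum.mono_neutral_cong_right) (auto simp: q_def)
  ultimately show ?thesis
    using \<Phi> P by (simp add: feasible_def unitary_mat_def)
qed

text \<open>This \<Phi> cancels the two inner unitary factors, so the singular values meet in their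
  given order and the channel becomes \<open>UB * R * mat_adjoint VF\<close> with \<open>R\<close>
  rectangular diagonal. The covariance is expressed in the basis \<open>VF\<close>, which cancels
  too.\<close>

lemma cascade_det_wf_covariance:
  assumes F: "is_svd K N HF UF sF VF" and B: "is_svd M K HB UB sB VB" and dims: "N \<le> K"
  shows "det (1\<^sub>m M + complex_of_real c \<cdot>\<^sub>m (HB * (VB * mat_adjoint UF) * HF *
      wf_covariance (min N M) N VF p * mat_adjoint (HB * (VB * mat_adjoint UF) * HF))) =
    complex_of_real (\<Prod>i<min N M. 1 + (sF i)\<^sup>2 * (sB i)\<^sup>2 * (c * p i))"
proof -
  define q where "q i = (if i < min N M then p i else 0)" for i
  define E where "E = mat_diag N (\<lambda>i. complex_of_real (q i))"
  define R where "R = rect_diag M N (\<lambda>i. sB i * sF i)"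
  define D where "D = mat_diag M (\<lambda>i. complex_of_real (if i < N then (sB i * sF i)\<^sup>2 * q i else 0))"
  have pd: "power_diag (min N M) N p = E"
    unfolding power_diag_def E_def by (intro eq_matI) (auto simp: mat_diag_def q_def)
  have UF: "UF \<in> carrier_mat K K" "mat_adjoint UF * UF = 1\<^sub>m K"
    and VF: "VF \<in> carrier_mat N N" "mat_adjoint VF * VF = 1\<^sub>m N"
    and UB: "UB \<in> carrier_mat M M" "mat_adjoint UB * UB = 1\<^sub>m M"
    and VB: "VB \<in> carrier_mat K K" "mat_adjoint VB * VB = 1\<^sub>m K"
    and HF: "HF = UF * rect_diag K N sF * mat_adjoint VF"
    and HB: "HB = UB * rect_diag M K sB * mat_adjoint VB"
    using F B by (auto simp: is_svd_def unitary_mat_def)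
  have Rc: "R \<in> carrier_mat M N" and Ec: "E \<in> carrier_mat N N" and Dc: "D \<in> carrier_mat M M"
    by (auto simp: R_def E_def D_def)
  define A where "A = HB * (VB * mat_adjoint UF) * HF"
  have A_eq: "A = UB * R * mat_adjoint VF"
  proof -
    have "A = UB * (rect_diag M K sB * ((mat_adjoint VB * VB) * ((mat_adjoint UF * UF) *
        (rect_diag K N sF * mat_adjoint VF))))"
      unfolding A_def HB HF using UF(1) VF(1) UB(1) VB(1)
      by (simp add: assoc_mult_mat[of _ M M _ K _ K] assoc_mult_mat[of _ M K _ K _ K]
          assoc_mult_mat[of _ K K _ K _ K] assoc_mult_mat[of _ M M _ K _ N] assoc_mult_mat[of _ M K _ K _ N]
          assoc_mult_mat[of _ K K _ K _ N] assoc_mult_mat[of _ K K _ N _ N] assoc_mult_mat[of _ K N _ N _ N]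
          mult_carrier_mat[of _ K K _ K] mult_carrier_mat[of _ M K _ K] mult_carrier_mat[of _ K K _ N]
          mult_carrier_mat[of _ K N _ N] mult_carrier_mat[of _ M K _ N] mult_carrier_mat[of _ M M _ K])
    also have "\<dots> = UB * (rect_diag M K sB * (rect_diag K N sF * mat_adjoint VF))"
      using VF(1) by (simp add: UF(2) VB(2) left_mult_one_mat[of _ K N] mult_carrier_mat[of _ K N _ N])
    also have "\<dots> = UB * (rect_diag M K sB * rect_diag K N sF) * mat_adjoint VF"
      using VF(1) UB(1)
      by (simp add: assoc_mult_mat[of _ M K _ N _ N] assoc_mult_mat[of _ M M _ N _ N] mult_carrier_mat[of _ M K _ N])
    also have "rect_diag M K sB * rect_diag K N sF = R"
      using dims by (simp add: rect_diag_mult R_def)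
    finally show ?thesis .
  qed
  have UBR: "UB * R \<in> carrier_mat M N" using UB(1) Rc by (rule mult_carrier_mat)
  have VF': "mat_adjoint VF \<in> carrier_mat N N" and UB': "mat_adjoint UB \<in> carrier_mat M M"
    and R': "mat_adjoint R \<in> carrier_mat N M"
    using VF UB Rc by auto
  have adjA: "mat_adjoint A = VF * (mat_adjoint R * mat_adjoint UB)"
    unfolding A_eq mat_adjoint_mult[OF UBR VF'] mat_adjoint_mult[OF UB(1) Rc] by simp
  note simps = assoc_mult_mat[of _ M M _ N _ N] assoc_mult_mat[of _ M N _ N _ N]
    assoc_mult_mat[of _ M N _ N _ M] assoc_mult_mat[of _ N N _ N _ M] assoc_mult_mat[of _ N N _ M _ M]
    assoc_mult_mat[of _ M N _ M _ M] assoc_mult_mat[of _ M M _ N _ M] assoc_mult_mat[of _ N N _ N _ N]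
    assoc_mult_mat[of _ M M _ M _ M]
    mult_carrier_mat[of _ M N _ N] mult_carrier_mat[of _ N N _ N] mult_carrier_mat[of _ N M _ M]
    mult_carrier_mat[of _ N N _ M] mult_carrier_mat[of _ M N _ M] mult_carrier_mat[of _ M M _ N]
    mult_carrier_mat[of _ M M _ M]
  have "A * (VF * E * mat_adjoint VF) * mat_adjoint A =
      UB * (R * ((mat_adjoint VF * VF) * (E * ((mat_adjoint VF * VF) * (mat_adjoint R * mat_adjoint UB)))))"
    unfolding adjA unfolding A_eq using UB(1) Rc VF(1) Ec VF' UB' R' by (simp add: simps)
  also have "\<dots> = UB * (R * E * mat_adjoint R * mat_adjoint UB)"
    using UB(1) Rc Ec UB' R'
    by (simp add: VF(2) simps left_mult_one_mat[of _ N M])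
  also have "R * E * mat_adjoint R = D"
    unfolding R_def E_def D_def by (rule rect_diag_mult_mat_diag_adjoint)
  finally have AQA: "A * (VF * E * mat_adjoint VF) * mat_adjoint A = UB * (D * mat_adjoint UB)" .
  have DU: "D * mat_adjoint UB \<in> carrier_mat M M" using Dc UB' by (rule mult_carrier_mat)
  \<comment> \<open>The last unitary factor \<open>UB\<close> is moved cyclically to meet its
    adjoint, leaving a diagonal matrix. Its entries beyond \<open>min N M\<close> are 1.\<close>
  have "det (1\<^sub>m M + complex_of_real c \<cdot>\<^sub>m (UB * (D * mat_adjoint UB))) =
      det (1\<^sub>m M + UB * (complex_of_real c \<cdot>\<^sub>m (D * mat_adjoint UB)))"
    by (simp only: mult_smult_distrib[OF UB(1) DU])
  also have "\<dots> = det (1\<^sub>m M + complex_of_real c \<cdot>\<^sub>m (D * mat_adjoint UB) * UB)"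
    using UB(1) DU by (intro det_one_add_mult_comm) auto
  also have "complex_of_real c \<cdot>\<^sub>m (D * mat_adjoint UB) * UB = complex_of_real c \<cdot>\<^sub>m D"
    using mult_smult_assoc_mat[OF DU UB(1)] assoc_mult_mat[OF Dc UB' UB(1)] Dc
    by (simp add: UB(2) right_mult_one_mat[OF Dc])
  also have "1\<^sub>m M + complex_of_real c \<cdot>\<^sub>m D =
      mat_diag M (\<lambda>i. complex_of_real (1 + c * (if i < N then (sB i * sF i)\<^sup>2 * q i else 0)))"
    by (intro eq_matI) (auto simp: D_def mat_diag_def)
  also have "det \<dots> = complex_of_real (\<Prod>i<M. 1 + c * (if i < N then (sB i * sF i)\<^sup>2 * q i else 0))"
    by (simp only: det_mat_diag of_real_prod)
  also have "(\<Prod>i<M. 1 + c * (if i < N then (sB i * sF i)\<^sup>2 * q i else 0)) =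
      (\<Prod>i<min N M. 1 + (sF i)\<^sup>2 * (sB i)\<^sup>2 * (c * p i))"
    by (intro prod.mono_neutral_cong_right) (auto simp: q_def power_mult_distrib mult_ac)
  finally show ?thesis
    unfolding A_def[symmetric] wf_covariance_def pd AQA .
qed

text \<open>The condition on \<mu> is an implication because no level satisfies the power identity
  when every product \<open>sF i * sB i\<close> is 0. All powers are then 0 at any level, and so is
  the capacity. That the maximum defining \<open>capacity\<close> exists is expressed by the bound
  for all feasible pairs together with the pair attaining it.\<close>

theorem proposition1:
  fixes N M K :: nat
    and HF UF VF HB UB VB :: "complex mat"
    and sF sB :: "nat \<Rightarrow> real"
    and P noise b :: real
  assumes "0 < N" and "0 < M" and "N < K" and "M < K"
    and "HF \<in> carrier_mat K N" and "HB \<in> carrier_mat M K"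
    and "0 < P" and "0 < noise" and "1 < b"
    and "is_svd K N HF UF sF VF"
    and "is_svd M K HB UB sB VB"
  shows
    "((\<exists>i < min N M. sF i * sB i \<noteq> 0) \<longrightarrow>
        (\<exists>!\<mu>. (\<Sum>i < min N M. wf_power sF sB noise \<mu> i) = P)) \<and>
     (\<forall>\<mu>. ((\<exists>i < min N M. sF i * sB i \<noteq> 0) \<longrightarrow>
             (\<Sum>i < min N M. wf_power sF sB noise \<mu> i) = P) \<longrightarrow>
        capacity N K b P noise HF HB =
          (\<Sum>i < min N M. log b (1 + (sF i)\<^sup>2 * (sB i)\<^sup>2 * (wf_power sF sB noise \<mu> i / noise))) \<and>
        (\<forall>Q \<Phi>. feasible N K P Q \<Phi> \<longrightarrow>
           rate b noise (HB * \<Phi> * HF) Q \<le> capacity N K b P noise HF HB) \<and>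
        feasible N K P
          (wf_covariance (min N M) N VF (wf_power sF sB noise \<mu>)) (VB * mat_adjoint UF) \<and>
        rate b noise (HB * (VB * mat_adjoint UF) * HF)
            (wf_covariance (min N M) N VF (wf_power sF sB noise \<mu>)) =
          capacity N K b P noise HF HB)"
proof (intro conjI impI allI)
  let ?r = "min N M"
  let ?p = "wf_power sF sB noise"
  note dims = less_imp_le[OF \<open>N < K\<close>] less_imp_le[OF \<open>M < K\<close>]
  note F = \<open>is_svd K N HF UF sF VF\<close> and B = \<open>is_svd M K HB UB sB VB\<close>
  show "\<exists>!\<mu>. (\<Sum>i<?r. ?p \<mu> i) = P" if "\<exists>i<?r. sF i * sB i \<noteq> 0"
    using \<open>0 < noise\<close> \<open>0 < P\<close> that by (rule water_level_exists_unique)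
  fix \<mu> assume level: "(\<exists>i<?r. sF i * sB i \<noteq> 0) \<longrightarrow> (\<Sum>i<?r. ?p \<mu> i) = P"
  let ?C = "\<Sum>i<?r. log b (1 + (sF i)\<^sup>2 * (sB i)\<^sup>2 * (?p \<mu> i / noise))"
  let ?Q = "wf_covariance ?r N VF (?p \<mu>)" and ?\<Phi> = "VB * mat_adjoint UF"
  have ln_b: "0 < ln b" using \<open>1 < b\<close> by simp
  have C_eq: "?C = (\<Sum>i<?r. ln (1 + (sF i)\<^sup>2 * (sB i)\<^sup>2 * (?p \<mu> i / noise))) / ln b"
    by (simp add: log_def sum_divide_distrib)
  have carrier: "HB * \<Phi> * HF \<in> carrier_mat M N" if "\<Phi> \<in> carrier_mat K K" for \<Phi>
    using mult_carrier_mat[OF mult_carrier_mat[OF \<open>HB \<in> carrier_mat M K\<close> that] \<open>HF \<in> carrier_mat K N\<close>] .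
  have \<Phi>: "unitary_mat K ?\<Phi>"
    using F B by (intro unitary_mat_mult unitary_mat_adjoint) (auto simp: is_svd_def)
  have upper: "rate b noise (HB * \<Phi> * HF) Q \<le> ?C" if feas: "feasible N K P Q \<Phi>" for Q \<Phi>
  proof -
    have \<Phi>c: "\<Phi> \<in> carrier_mat K K" using feas by (simp add: feasible_def)
    let ?x = "ln (Re (det (1\<^sub>m M + complex_of_real (1 / noise) \<cdot>\<^sub>m
      (HB * \<Phi> * HF * Q * mat_adjoint (HB * \<Phi> * HF)))))"
    note bound = cascade_ln_det_le[OF F B dims feas \<open>0 < noise\<close>]
    have "?x \<le> (\<Sum>i<?r. ln (1 + (sF i)\<^sup>2 * (sB i)\<^sup>2 * (?p \<mu> i / noise)))"
    proof (cases "\<exists>i<?r. sF i * sB i \<noteq> 0")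
      case True
      then have sum: "(\<Sum>i<?r. ?p \<mu> i) = P" using level by blast
      have "0 < \<mu>"
      \<comment> \<open>A nonpositive level leaves every channel empty, against the positive total
        \<open>P\<close>.\<close>
      proof (rule ccontr)
        assume "\<not> 0 < \<mu>"
        then have "(\<Sum>i<?r. ?p \<mu> i) = 0"
          using \<open>0 < noise\<close> by (intro sum.neutral) (auto intro: wf_power_nonpos_level)
        with sum \<open>0 < P\<close> show False by simp
      qed
      with bound[of \<mu>] show ?thesis
        by (simp only: sum_ln_rate_wf_power[OF \<open>0 < noise\<close> _ sum])
    next
      case False
      then have zero: "sF i = 0 \<or> sB i = 0" if "i < ?r" for i
        using that by auto
      then have gain: "(sF i)\<^sup>2 * (sB i)\<^sup>2 = 0" if "i < ?r" for i
        using that by fastforce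
      have "?x \<le> 0"
      proof (rule ccontr)
        assume "\<not> ?x \<le> 0"
        then have pos: "0 < ?x" by simp
        \<comment> \<open>All gains are 0, so the dual bound is \<open>P / \<mu>\<close> for any
          positive \<mu>. The choice \<open>2 * P / ?x\<close> turns it into \<open>?x / 2\<close>,
          which is below \<open>?x\<close>.\<close>
        have "?x \<le> P / (2 * P / ?x) + (\<Sum>i<?r. wf_dual (2 * P / ?x * ((sF i)\<^sup>2 * (sB i)\<^sup>2 / noise)))"
          using pos \<open>0 < P\<close> by (intro bound) simp
        also have "(\<Sum>i<?r. wf_dual (2 * P / ?x * ((sF i)\<^sup>2 * (sB i)\<^sup>2 / noise))) = 0"
          by (intro sum.neutral) (simp add: gain wf_dual_eq_0 del: mult_eq_0_iff)
        also have "P / (2 * P / ?x) + 0 = ?x / 2"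
          using \<open>0 < P\<close> by simp
        finally show False using pos by linarith
      qed
      also have "0 = (\<Sum>i<?r. ln (1 + (sF i)\<^sup>2 * (sB i)\<^sup>2 * (?p \<mu> i / noise)))"
        by (intro sum.neutral[symmetric]) (simp add: gain del: mult_eq_0_iff)
      finally show ?thesis .
    qed
    then show ?thesis
      unfolding C_eq rate_eq[OF carrier[OF \<Phi>c]] using ln_b by (intro divide_right_mono) auto
  qed
  \<comment> \<open>Equality holds at a water level; without usable channels the sum is 0, and the
    power constraint still holds.\<close>
  have "(\<Sum>i<?r. ?p \<mu> i) \<le> P"
  proof (cases "\<exists>i<?r. sF i * sB i \<noteq> 0")
    case False
    then have "(\<Sum>i<?r. ?p \<mu> i) = 0" by (intro sum.neutral) (auto simp: wf_power_def)
    then show ?thesis using \<open>0 < P\<close> by simp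
  qed (use level in auto)
  then show feas: "feasible N K P ?Q ?\<Phi>"
    using F \<Phi> by (intro wf_covariance_feasible) (auto simp: is_svd_def wf_power_nonneg)
  have nonneg: "0 \<le> (sF i)\<^sup>2 * (sB i)\<^sup>2 * (?p \<mu> i / noise)" for i
    using \<open>0 < noise\<close> wf_power_nonneg[of sF sB noise \<mu> i] by simp
  have attained: "rate b noise (HB * ?\<Phi> * HF) ?Q = ?C"
  proof -
    have "rate b noise (HB * ?\<Phi> * HF) ?Q =
        ln (\<Prod>i<?r. 1 + (sF i)\<^sup>2 * (sB i)\<^sup>2 * (1 / noise * ?p \<mu> i)) / ln b"
      unfolding rate_eq[OF carrier[OF unitary_mat_carrier[OF \<Phi>]]]
        cascade_det_wf_covariance[OF F B dims(1)] by (simp del: of_real_prod)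
    also have "(\<Prod>i<?r. 1 + (sF i)\<^sup>2 * (sB i)\<^sup>2 * (1 / noise * ?p \<mu> i)) =
        (\<Prod>i<?r. 1 + (sF i)\<^sup>2 * (sB i)\<^sup>2 * (?p \<mu> i / noise))"
      by simp
    also have "ln \<dots> = (\<Sum>i<?r. ln (1 + (sF i)\<^sup>2 * (sB i)\<^sup>2 * (?p \<mu> i / noise)))"
      using nonneg by (intro ln_prod) (auto simp: add_nonneg_eq_0_iff)
    finally show ?thesis by (simp only: C_eq)
  qed
  show capacity: "capacity N K b P noise HF HB = ?C"
    unfolding capacity_def
    by (rule Greatest_equality) (use feas attained upper in \<open>metis, auto\<close>)
  show "rate b noise (HB * \<Phi> * HF) Q \<le> capacity N K b P noise HF HB"
    if "feasible N K P Q \<Phi>" for Q \<Phi>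
    unfolding capacity using that by (rule upper)
  show "rate b noise (HB * ?\<Phi> * HF) ?Q = capacity N K b P noise HF HB"
    unfolding capacity by (rule attained)
qed

end
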